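(* Let $\mathbb{P}$ and $\mathbb{P}'$ be probability measures on a product measurable space $(\Omega,\mathcal{A})=\bigl(\prod_{i\in I}\Omega_i,\bigotimes_{i\in I}\mathcal{A}_i\bigr)$, where $I$ is an arbitrary index set, such that $\mathbb{P}_{\pi_J}\sim\mathbb{P}'_{\pi_J}$ for all finite $J\subseteq I$. For finite $J,K\subseteq I$ let $\Phi_J=\frac{d\mathbb{P}'_{\pi_J}}{d\mathbb{P}_{\pi_J}}$ and $\varphi_{J,K}=\frac{\Phi_J}{\Phi_K}$. Then for every increasing sequence $J=(J_n)_{n\in\mathbb{N}}$ of finite subsets of $I$ with $J_1=\emptyset$, the random variable $$M_J=\lim_{n\to\infty}\lim_{k\to\infty}\mathbb{E}\Bigl(\prod_{i=n}^{k}\sqrt{\varphi_{J_{i+1},J_i}}\,\Big|\,\pi_{J_n}\Bigr)$$ exists $(\mathbb{P}+\mathbb{P}')$-almost everywhere. Furthermore, $\mathbb{P}\sim\mathbb{P}'$ if and only if $M_J=1$ $(\mathbb{P}+\mathbb{P}')$-almost everywhere for all increasing sequences $J=(J_n)_{n\in\mathbb{N}}$ of finite subsets of $I$ with $J_1=\emptyset$. In this case, for any such sequence $(J_n)_{n\in\mathbb{N}}$ and $K=\bigcup_{n\in\mathbb{N}}J_n$, one has $(\Phi_{J_n})^{1/2}\to\bigl(\frac{d\mathbb{P}'_{\pi_K}}{d\mathbb{P}_{\pi_K}}\bigr)^{1/2}$ in $L^2(\mathbb{P})$.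
   Context: $\mathbb{N}=\{1,2,\dots\}$; $\sim$ denotes mutual absolute continuity. For $J\subseteq I$, $\pi_J:\Omega\to\prod_{i\in J}\Omega_i$ is the projection, and $\mathbb{P}_{\pi_J}$, $\mathbb{P}'_{\pi_J}$ are the laws (pushforwards) of $\pi_J$ under $\mathbb{P}$, $\mathbb{P}'$ on $\bigl(\prod_{i\in J}\Omega_i,\bigotimes_{i\in J}\mathcal{A}_i\bigr)$. Radon-Nikodym derivatives of such laws are regarded as functions on $\Omega$ by composing with $\pi_J$; for finite $J$, $\Phi_J$ is chosen with values in $(0,\infty)$, and $\Phi_\emptyset=1$. "Increasing" means $J_n\subseteq J_{n+1}$. $\mathbb{E}$ is expectation under $\mathbb{P}$, and $\mathbb{E}(\cdot\mid\pi_{J_n})$ is conditional expectation given $\sigma(\pi_{J_n})$. *)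

theory Defs
  imports "HOL-Probability.Probability"
begin

definition mutually_abs_cont :: "'a measure \<Rightarrow> 'a measure \<Rightarrow> bool" where
  "mutually_abs_cont M N \<longleftrightarrow> absolutely_continuous M N \<and> absolutely_continuous N M"

(* Only used for measures on the same sigma-algebra. *)
definition sum_of_measures :: "'a measure \<Rightarrow> 'a measure \<Rightarrow> 'a measure" where
  "sum_of_measures M N =
     measure_of (space M) (sets M) (\<lambda>X. emeasure M X + emeasure N X)"

lemma space_sum_of_measures [simp]: "space (sum_of_measures M N) = space M"
  and sets_sum_of_measures [simp, measurable_cong]: "sets (sum_of_measures M N) = sets M"
  by (simp_all add: sum_of_measures_def)

lemma emeasure_sum_of_measures:
  assumes "sets N = sets M" and "X \<in> sets M"
  shows "emeasure (sum_of_measures M N) X = emeasure M X + emeasure N X"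
  unfolding sum_of_measures_def
proof (rule emeasure_measure_of_sigma)
  show "sigma_algebra (space M) (sets M)" ..
  show "positive (sets M) (\<lambda>X. emeasure M X + emeasure N X)"
    by (simp add: positive_def)
  show "countably_additive (sets M) (\<lambda>X. emeasure M X + emeasure N X)"
    using assms(1)
    by (auto simp: countably_additive_def suminf_add[symmetric] suminf_emeasure)
qed (fact assms(2))

(* The coordinate projection from the product over I to the product over J is
   "\<lambda>\<omega>. restrict \<omega> J"; of each A i only the measurable space is used. *)
definition proj_law ::
    "('i \<Rightarrow> 'a measure) \<Rightarrow> ('i \<Rightarrow> 'a) measure \<Rightarrow> 'i set \<Rightarrow> ('i \<Rightarrow> 'a) measure" where
  "proj_law A P J = distr P (PiM J A) (\<lambda>\<omega>. restrict \<omega> J)"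

definition proj_sigma ::
    "('i \<Rightarrow> 'a measure) \<Rightarrow> ('i \<Rightarrow> 'a) measure \<Rightarrow> 'i set \<Rightarrow> ('i \<Rightarrow> 'a) measure" where
  "proj_sigma A P J = vimage_algebra (space P) (\<lambda>\<omega>. restrict \<omega> J) (PiM J A)"

(* \<Phi> is a choice, for every finite J, of a version of the Radon-Nikodym derivative of the
   J-marginal of P' with respect to that of P, with values in (0,\<infinity>) everywhere. *)
definition RN_versions ::
    "'i set \<Rightarrow> ('i \<Rightarrow> 'a measure) \<Rightarrow> ('i \<Rightarrow> 'a) measure \<Rightarrow> ('i \<Rightarrow> 'a) measure
      \<Rightarrow> ('i set \<Rightarrow> ('i \<Rightarrow> 'a) \<Rightarrow> real) \<Rightarrow> bool" where
  "RN_versions I A P P' \<Phi> \<longleftrightarrow>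
     (\<forall>J. finite J \<and> J \<subseteq> I \<longrightarrow>
        \<Phi> J \<in> borel_measurable (PiM J A) \<and>
        (\<forall>x\<in>space (PiM J A). 0 < \<Phi> J x) \<and>
        (AE x in proj_law A P J.
           ennreal (\<Phi> J x) = RN_deriv (proj_law A P J) (proj_law A P' J) x)) \<and>
     (\<forall>x\<in>space (PiM {} A). \<Phi> {} x = 1)"

definition deriv_ratio ::
    "('i set \<Rightarrow> ('i \<Rightarrow> 'a) \<Rightarrow> real) \<Rightarrow> 'i set \<Rightarrow> 'i set \<Rightarrow> ('i \<Rightarrow> 'a) \<Rightarrow> real" where
  "deriv_ratio \<Phi> J K \<omega> = \<Phi> J (restrict \<omega> J) / \<Phi> K (restrict \<omega> K)"

(* Sequences are indexed by {1,2,...}; the value at index 0 is irrelevant throughout. *)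
definition admissible_seq :: "'i set \<Rightarrow> (nat \<Rightarrow> 'i set) \<Rightarrow> bool" where
  "admissible_seq I J \<longleftrightarrow>
     J 1 = {} \<and> (\<forall>n\<ge>1. finite (J n) \<and> J n \<subseteq> I \<and> J n \<subseteq> J (Suc n))"

definition cond_prod ::
    "('i \<Rightarrow> 'a measure) \<Rightarrow> ('i \<Rightarrow> 'a) measure \<Rightarrow> ('i set \<Rightarrow> ('i \<Rightarrow> 'a) \<Rightarrow> real)
      \<Rightarrow> (nat \<Rightarrow> 'i set) \<Rightarrow> nat \<Rightarrow> nat \<Rightarrow> ('i \<Rightarrow> 'a) \<Rightarrow> real" where
  "cond_prod A P \<Phi> J n k =
     real_cond_exp P (proj_sigma A P (J n))
       (\<lambda>\<omega>. \<Prod>i=n..k. sqrt (deriv_ratio \<Phi> (J (Suc i)) (J i) \<omega>))"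

definition M_exists_at ::
    "('i \<Rightarrow> 'a measure) \<Rightarrow> ('i \<Rightarrow> 'a) measure \<Rightarrow> ('i set \<Rightarrow> ('i \<Rightarrow> 'a) \<Rightarrow> real)
      \<Rightarrow> (nat \<Rightarrow> 'i set) \<Rightarrow> ('i \<Rightarrow> 'a) \<Rightarrow> bool" where
  "M_exists_at A P \<Phi> J \<omega> \<longleftrightarrow>
     (\<forall>n\<ge>1. convergent (\<lambda>k. cond_prod A P \<Phi> J n k \<omega>)) \<and>
     convergent (\<lambda>n. lim (\<lambda>k. cond_prod A P \<Phi> J n k \<omega>))"

(* Meaningful only at points where M_exists_at holds: lim is arbitrary for divergent sequences. *)
definition M_lim ::
    "('i \<Rightarrow> 'a measure) \<Rightarrow> ('i \<Rightarrow> 'a) measure \<Rightarrow> ('i set \<Rightarrow> ('i \<Rightarrow> 'a) \<Rightarrow> real)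
      \<Rightarrow> (nat \<Rightarrow> 'i set) \<Rightarrow> ('i \<Rightarrow> 'a) \<Rightarrow> real" where
  "M_lim A P \<Phi> J \<omega> = lim (\<lambda>n. lim (\<lambda>k. cond_prod A P \<Phi> J n k \<omega>))"

definition in_L2 :: "'a measure \<Rightarrow> ('a \<Rightarrow> real) \<Rightarrow> bool" where
  "in_L2 M f \<longleftrightarrow> f \<in> borel_measurable M \<and> integrable M (\<lambda>x. (f x)\<^sup>2)"

definition tendsto_L2 :: "'a measure \<Rightarrow> (nat \<Rightarrow> 'a \<Rightarrow> real) \<Rightarrow> ('a \<Rightarrow> real) \<Rightarrow> bool" where
  "tendsto_L2 M f g \<longleftrightarrow>
     (\<forall>n\<ge>1. in_L2 M (f n)) \<and> in_L2 M g \<and>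
     (\<lambda>n. \<integral>x. (f n x - g x)\<^sup>2 \<partial>M) \<longlonglongrightarrow> 0"

end

theory Submission
  imports Defs
begin

text \<open>
  Take \<open>S = P + P'\<close> as reference measure and let \<open>d\<close> be the density of \<open>P\<close> with respect to
  \<open>S\<close>, so that \<open>1 - d\<close> is the density of \<open>P'\<close>. Fix a sequence \<open>J\<close> with union \<open>K\<close>, and write \<open>F n\<close> for
  the \<open>\<sigma>\<close>-algebra of the coordinates in the \<open>n\<close>-th set, \<open>G\<close> for the one of the coordinates in \<open>K\<close>,
  \<open>X n = E_S(d | F n)\<close> and \<open>Y = E_S(d | G)\<close>. Then the derivative on \<open>F n\<close> is
  \<open>L n = (1 - X n) / X n\<close>, the product of the square roots telescopes to \<open>sqrt (L k / L n)\<close>,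
  and Bayes' formula turns its conditional expectation under \<open>P\<close> into

    \<open>E_P(sqrt (L k / L n) | F n) = E_S(u k | F n) / u n\<close>  with  \<open>u k = sqrt (X k * (1 - X k))\<close>.

  This expression is symmetric in \<open>P\<close> and \<open>P'\<close> and involves only bounded functions under one
  finite measure; the part of the space where the derivatives tend to infinity is treated like the part
  where they tend to 0.

  Levy's upward theorem gives \<open>X n \<longlonglongrightarrow> Y\<close>. Hence the limit in \<open>k\<close> is
  \<open>E_S(z | F n) / u n\<close> with \<open>z = sqrt (Y * (1 - Y))\<close>, by conditional dominated convergence. Where
  \<open>0 < Y < 1\<close>, numerator and denominator both tend to \<open>z > 0\<close> and the ratio tends to 1. Where \<open>Y\<close> is
  0 or 1 both tend to 0, but the conditional Cauchy-Schwarz inequality shows that the ratio tends to 0: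
  this is \<open>affinity_ratio_limit\<close>, the heart of the matter. So the iterated limit exists almost everywhere
  and is the indicator of \<open>0 < Y < 1\<close>.

  It equals 1 almost everywhere iff \<open>0 < Y < 1\<close> almost everywhere, which says that \<open>P\<close> and \<open>P'\<close>
  have the same null sets in \<open>G\<close> (\<open>equivalent_iff_cond_density_strict\<close>). As every measurable set of the
  product depends on countably many coordinates, and every countable \<open>K\<close> is exhausted by an admissible
  sequence, the condition for all sequences amounts to the equivalence of \<open>P\<close> and \<open>P'\<close>. In that
  case \<open>L n\<close> converges almost everywhere to the derivative on \<open>G\<close>, all these functions have integral 1,
  and Scheffe's lemma with \<open>(sqrt a - sqrt b)\<^sup>2 \<le> \<bar>a - b\<bar>\<close> gives the convergence in \<open>L\<^sup>2\<close>.
\<close>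

section \<open>Levy's upward theorem for finite measures\<close>

text \<open>Finite measures instead of probability measures, because the results are applied to the sum of two
  probability measures.\<close>

locale finite_filtration = finite_measure M for M :: "'a measure" +
  fixes F :: "nat \<Rightarrow> 'a measure" and G :: "'a measure"
  assumes subalgebra_F: "\<And>n. subalgebra M (F n)"
    and mono_F: "\<And>m n. m \<le> n \<Longrightarrow> sets (F m) \<subseteq> sets (F n)"
    and space_G: "space G = space M"
    and sets_G: "sets G = sigma_sets (space M) (\<Union>n. sets (F n))"
begin

lemma space_F: "space (F n) = space M"
  using subalgebra_F[of n] by (simp add: subalgebra_def)

lemma F_sub_G: "sets (F n) \<subseteq> sets G"
  by (auto simp: sets_G)

lemma subalgebra_G: "subalgebra M G"
  unfolding subalgebra_def
proof
  show "sets G \<subseteq> sets M"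
    unfolding sets_G using subalgebra_F by (intro sets.sigma_sets_subset) (auto simp: subalgebra_def)
qed (rule space_G)

lemma subalgebra_G_F: "subalgebra G (F n)"
  using F_sub_G by (simp add: subalgebra_def space_F space_G)

lemma subalgebra_F_F: "m \<le> n \<Longrightarrow> subalgebra (F n) (F m)"
  using mono_F by (simp add: subalgebra_def space_F)

lemma finite_measure_subalgebra_F: "finite_measure_subalgebra M (F n)"
  by unfold_locales (rule subalgebra_F)

lemma sigma_finite_subalgebra_F: "sigma_finite_subalgebra M (F n)"
  using finite_measure_subalgebra_is_sigma_finite[OF finite_measure_subalgebra_F] .

lemma sigma_finite_subalgebra_G: "sigma_finite_subalgebra M G"
proof -
  interpret finite_measure_subalgebra M G by unfold_locales (rule subalgebra_G)
  show ?thesis by (rule sigma_finite_subalgebra_axioms)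
qed

lemma integrable_indicator_finite [simp]: "A \<in> sets M \<Longrightarrow> integrable M (indicator A :: 'a \<Rightarrow> real)"
  by (simp add: less_top[symmetric])

text \<open>Split the event according to the first \<open>n\<close> at which the conditional expectation reaches the level
  \<open>c\<close>. The piece \<open>B n\<close> belongs to \<open>F n\<close>, so on it the conditional expectation, which is at least
  \<open>c\<close> there, has the same integral as \<open>f\<close>. The pieces are disjoint, so these integrals add up to at
  most the integral of \<open>f\<close>.\<close>

lemma Doob_maximal_inequality:
  assumes f: "f \<in> borel_measurable M"
  shows "c * emeasure M {x\<in>space M. \<exists>n. c \<le> nn_cond_exp M (F n) f x} \<le> (\<integral>\<^sup>+x. f x \<partial>M)"
proof -
  define A where "A n = {x\<in>space M. c \<le> nn_cond_exp M (F n) f x}" for n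
  have A_F: "A n \<in> sets (F n)" for n
  proof -
    have "{x\<in>space (F n). c \<le> nn_cond_exp M (F n) f x} \<in> sets (F n)" by measurable
    then show ?thesis by (simp add: A_def space_F)
  qed
  define B where "B = disjointed A"
  have B_F: "B n \<in> sets (F n)" for n
  proof -
    have "A i \<in> sets (F n)" if "i < n" for i using A_F[of i] mono_F[of i n] that by auto
    then show ?thesis unfolding B_def disjointed_def using A_F[of n] by (intro sets.Diff sets.finite_UN) auto
  qed
  have B_M: "B n \<in> sets M" for n using B_F[of n] subalgebra_F[of n] by (auto simp: subalgebra_def)
  have BA: "x \<in> B n \<Longrightarrow> c \<le> nn_cond_exp M (F n) f x" for x n
    using disjointed_subset[of A n] by (auto simp: B_def A_def)
  have disj: "disjoint_family B" unfolding B_def by (rule disjoint_family_disjointed)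
  have "{x\<in>space M. \<exists>n. c \<le> nn_cond_exp M (F n) f x} = (\<Union>n. B n)"
    unfolding B_def UN_disjointed_eq by (auto simp: A_def)
  then have "c * emeasure M {x\<in>space M. \<exists>n. c \<le> nn_cond_exp M (F n) f x} = c * (\<Sum>n. emeasure M (B n))"
    using suminf_emeasure[of B M] disj B_M by (simp add: image_subset_iff)
  also have "\<dots> = (\<Sum>n. c * emeasure M (B n))" by simp
  also have "\<dots> \<le> (\<Sum>n. \<integral>\<^sup>+x. f x * indicator (B n) x \<partial>M)"
  proof (intro suminf_le allI)
    fix n
    interpret sigma_finite_subalgebra M "F n" by (rule sigma_finite_subalgebra_F)
    have "c * emeasure M (B n) = (\<integral>\<^sup>+x. c * indicator (B n) x \<partial>M)"
      using B_M by (simp add: nn_integral_cmult_indicator)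
    also have "\<dots> \<le> (\<integral>\<^sup>+x. indicator (B n) x * nn_cond_exp M (F n) f x \<partial>M)"
      by (intro nn_integral_mono) (auto simp: indicator_def BA)
    also have "\<dots> = (\<integral>\<^sup>+x. indicator (B n) x * f x \<partial>M)"
      using B_F f by (intro nn_cond_exp_intg) auto
    finally show "c * emeasure M (B n) \<le> (\<integral>\<^sup>+x. f x * indicator (B n) x \<partial>M)"
      by (simp add: mult.commute)
  qed auto
  also have "\<dots> = (\<integral>\<^sup>+x. (\<Sum>n. f x * indicator (B n) x) \<partial>M)"
    using f B_M by (intro nn_integral_suminf[symmetric]) auto
  also have "\<dots> \<le> (\<integral>\<^sup>+x. f x \<partial>M)"
  proof (intro nn_integral_mono)
    fix x
    have "(\<Sum>n. f x * indicator (B n) x) = f x * indicator (\<Union>n. B n) x"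
      using suminf_indicator[OF disj, of x] by simp
    also have "\<dots> \<le> f x" by (simp add: indicator_def)
    finally show "(\<Sum>n. f x * indicator (B n) x) \<le> f x" .
  qed
  finally show ?thesis .
qed

text \<open>Membership in the \<open>L\<^sup>1\<close>-closure of the functions that are measurable at some finite time, for which
  the conditional expectations are eventually constant. That all integrable \<open>G\<close>-measurable functions belong
  to it is the density half of Levy's theorem; the maximal inequality is the other half.\<close>

definition L1_approximable :: "('a \<Rightarrow> real) \<Rightarrow> bool" where
  "L1_approximable f \<longleftrightarrow>
     (\<forall>e>0. \<exists>m. \<exists>g\<in>borel_measurable (F m). integrable M g \<and> (\<integral>x. \<bar>f x - g x\<bar> \<partial>M) < e)"

lemma L1_approximable_cong:
  assumes "\<And>x. x \<in> space M \<Longrightarrow> f x = g x"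
  shows "L1_approximable f \<longleftrightarrow> L1_approximable g"
proof -
  have "(\<integral>x. \<bar>f x - h x\<bar> \<partial>M) = (\<integral>x. \<bar>g x - h x\<bar> \<partial>M)" for h
    by (intro Bochner_Integration.integral_cong) (auto simp: assms)
  then show ?thesis by (simp add: L1_approximable_def)
qed

lemma L1_approximable_closure:
  assumes f: "integrable M f"
    and ex: "\<And>e. 0 < e \<Longrightarrow> \<exists>f'. integrable M f' \<and> L1_approximable f' \<and> (\<integral>x. \<bar>f x - f' x\<bar> \<partial>M) < e"
  shows "L1_approximable f"
  unfolding L1_approximable_def
proof (intro allI impI)
  fix e :: real assume "0 < e"
  then obtain f' where f': "integrable M f'" "L1_approximable f'" "(\<integral>x. \<bar>f x - f' x\<bar> \<partial>M) < e/2"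
    using ex[of "e/2"] by auto
  then obtain m g where g: "g \<in> borel_measurable (F m)" "integrable M g" "(\<integral>x. \<bar>f' x - g x\<bar> \<partial>M) < e/2"
    using \<open>0 < e\<close> unfolding L1_approximable_def by (meson half_gt_zero)
  have "(\<integral>x. \<bar>f x - g x\<bar> \<partial>M) \<le> (\<integral>x. \<bar>f x - f' x\<bar> + \<bar>f' x - g x\<bar> \<partial>M)"
    using f f'(1) g(2) by (intro integral_mono) auto
  also have "\<dots> = (\<integral>x. \<bar>f x - f' x\<bar> \<partial>M) + (\<integral>x. \<bar>f' x - g x\<bar> \<partial>M)"
    using f f'(1) g(2) by (intro Bochner_Integration.integral_add) auto
  also have "\<dots> < e" using f'(3) g(3) by simp
  finally show "\<exists>m. \<exists>g\<in>borel_measurable (F m). integrable M g \<and> (\<integral>x. \<bar>f x - g x\<bar> \<partial>M) < e"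
    using g by blast
qed

lemma L1_approximable_add:
  assumes f: "integrable M f" "L1_approximable f" and h: "integrable M h" "L1_approximable h"
  shows "L1_approximable (\<lambda>x. f x + h x)"
  unfolding L1_approximable_def
proof (intro allI impI)
  fix e :: real assume "0 < e"
  then obtain m g where g: "g \<in> borel_measurable (F m)" "integrable M g" "(\<integral>x. \<bar>f x - g x\<bar> \<partial>M) < e/2"
    using f unfolding L1_approximable_def by (meson half_gt_zero)
  from \<open>0 < e\<close> obtain m' g' where g': "g' \<in> borel_measurable (F m')" "integrable M g'" "(\<integral>x. \<bar>h x - g' x\<bar> \<partial>M) < e/2"
    using h unfolding L1_approximable_def by (meson half_gt_zero)
  have "g \<in> borel_measurable (F (max m m'))" "g' \<in> borel_measurable (F (max m m'))"
    using measurable_from_subalg[OF subalgebra_F_F[of m "max m m'"] g(1)]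
      measurable_from_subalg[OF subalgebra_F_F[of m' "max m m'"] g'(1)] by auto
  then have "(\<lambda>x. g x + g' x) \<in> borel_measurable (F (max m m'))" by simp
  moreover have "(\<integral>x. \<bar>f x + h x - (g x + g' x)\<bar> \<partial>M) \<le> (\<integral>x. \<bar>f x - g x\<bar> + \<bar>h x - g' x\<bar> \<partial>M)"
    using f h g g' by (intro integral_mono) auto
  moreover have "\<dots> = (\<integral>x. \<bar>f x - g x\<bar> \<partial>M) + (\<integral>x. \<bar>h x - g' x\<bar> \<partial>M)"
    using f h g g' by (intro Bochner_Integration.integral_add) auto
  ultimately show "\<exists>m. \<exists>g\<in>borel_measurable (F m). integrable M g \<and> (\<integral>x. \<bar>f x + h x - g x\<bar> \<partial>M) < e"
    using g g' by (intro exI[of _ "max m m'"] bexI[of _ "\<lambda>x. g x + g' x"] conjI) auto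
qed

lemma L1_approximable_cmult:
  assumes f: "integrable M f" "L1_approximable f"
  shows "L1_approximable (\<lambda>x. c * f x)"
  unfolding L1_approximable_def
proof (intro allI impI)
  fix e :: real assume "0 < e"
  then have "0 < e / (\<bar>c\<bar> + 1)" by simp
  then obtain m g where g: "g \<in> borel_measurable (F m)" "integrable M g" "(\<integral>x. \<bar>f x - g x\<bar> \<partial>M) < e / (\<bar>c\<bar> + 1)"
    using f unfolding L1_approximable_def by meson
  have "(\<integral>x. \<bar>c * f x - c * g x\<bar> \<partial>M) = \<bar>c\<bar> * (\<integral>x. \<bar>f x - g x\<bar> \<partial>M)"
    by (simp add: abs_mult right_diff_distrib[symmetric])
  also have "\<dots> \<le> (\<bar>c\<bar> + 1) * (\<integral>x. \<bar>f x - g x\<bar> \<partial>M)"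
    by (intro mult_right_mono) auto
  also have "\<dots> < e" using g(3) by (simp add: field_simps)
  finally show "\<exists>m. \<exists>g\<in>borel_measurable (F m). integrable M g \<and> (\<integral>x. \<bar>c * f x - g x\<bar> \<partial>M) < e"
    using g by (intro exI[of _ m] bexI[of _ "\<lambda>x. c * g x"] conjI) auto
qed

lemma L1_approximable_measurable:
  assumes "f \<in> borel_measurable (F m)" "integrable M f"
  shows "L1_approximable f"
  unfolding L1_approximable_def using assms by (auto intro!: exI[of _ m] bexI[of _ f])

lemma L1_approximable_limit:
  assumes s: "\<And>i. integrable M (s i)" "\<And>i. L1_approximable (s i)"
    and lim: "\<And>x. x \<in> space M \<Longrightarrow> (\<lambda>i. s i x) \<longlonglongrightarrow> f x"
    and bound: "\<And>i x. x \<in> space M \<Longrightarrow> \<bar>s i x\<bar> \<le> w x" and w: "integrable M w" and f: "integrable M f"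
  shows "L1_approximable f"
proof (rule L1_approximable_closure[OF f])
  fix e :: real assume e: "0 < e"
  have "(\<lambda>i. \<integral>x. \<bar>f x - s i x\<bar> \<partial>M) \<longlonglongrightarrow> (\<integral>x. 0 \<partial>M)"
  proof (rule integral_dominated_convergence[where w="\<lambda>x. \<bar>f x\<bar> + w x"])
    show "AE x in M. (\<lambda>i. \<bar>f x - s i x\<bar>) \<longlonglongrightarrow> 0"
    proof (rule AE_I2)
      fix x assume "x \<in> space M"
      from tendsto_rabs[OF tendsto_diff[OF tendsto_const[of "f x"] lim[OF this]]]
      show "(\<lambda>i. \<bar>f x - s i x\<bar>) \<longlonglongrightarrow> 0" by simp
    qed
    show "AE x in M. norm \<bar>f x - s i x\<bar> \<le> \<bar>f x\<bar> + w x" for i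
      using bound[of _ i] by (intro AE_I2) force
  qed (use f s w in auto)
  then have "eventually (\<lambda>i. (\<integral>x. \<bar>f x - s i x\<bar> \<partial>M) < e) sequentially"
    using e by (intro order_tendstoD) auto
  then obtain i where "(\<integral>x. \<bar>f x - s i x\<bar> \<partial>M) < e"
    by (auto simp: eventually_sequentially)
  with s show "\<exists>f'. integrable M f' \<and> L1_approximable f' \<and> (\<integral>x. \<bar>f x - f' x\<bar> \<partial>M) < e" by blast
qed

text \<open>The sets in some \<open>F n\<close> form an intersection-stable generator of \<open>G\<close>, so Dynkin's induction applies;
  disjoint unions are \<open>L\<^sup>1\<close>-limits of finite sums of indicators.\<close>

lemma L1_approximable_indicator:
  assumes "A \<in> sets G"
  shows "L1_approximable (indicator A :: 'a \<Rightarrow> real)"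
proof -
  have G_M: "A \<in> sets M" if "A \<in> sigma_sets (space M) (\<Union>n. sets (F n))" for A
    using that subalgebra_G by (auto simp: subalgebra_def sets_G)
  have Fpow: "(\<Union>n. sets (F n)) \<subseteq> Pow (space M)"
    using subalgebra_F sets.space_closed by (fastforce simp: subalgebra_def)
  have int: "Int_stable (\<Union>n. sets (F n))"
    unfolding Int_stable_def
  proof safe
    fix a b m n assume "a \<in> sets (F m)" "b \<in> sets (F n)"
    then have "a \<in> sets (F (max m n))" "b \<in> sets (F (max m n))"
      using mono_F[of m "max m n"] mono_F[of n "max m n"] by auto
    then show "a \<inter> b \<in> (\<Union>n. sets (F n))" by (intro UN_I[of "max m n"]) auto
  qed
  from assms show ?thesis unfolding sets_G
  proof (induction rule: sigma_sets_induct_disjoint[OF int Fpow, consumes 1, case_names basic empty compl union])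
    case (basic A)
    then obtain n where "A \<in> sets (F n)" by auto
    moreover from this have "A \<in> sets M" using subalgebra_F[of n] by (auto simp: subalgebra_def)
    ultimately show ?case by (intro L1_approximable_measurable[of _ n] integrable_indicator_finite) auto
  next
    case empty
    show ?case by (intro L1_approximable_measurable[of _ 0]) auto
  next
    case (compl A)
    have A: "A \<in> sets M" using G_M[OF compl(1)] .
    have "L1_approximable (\<lambda>x. 1 + (-1) * indicator A x)"
    proof (rule L1_approximable_add)
      show "L1_approximable (\<lambda>x. (-1) * indicator A x)"
        using A compl by (intro L1_approximable_cmult integrable_indicator_finite)
      show "integrable M (\<lambda>x. (-1) * indicator A x :: real)"
        using integrable_indicator_finite[OF A] by simp
    qed (auto intro: L1_approximable_measurable[of _ 0])
    then show ?case
      by (subst L1_approximable_cong[where g="\<lambda>x. 1 + (-1) * indicator A x"]) (auto simp: indicator_def)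
  next
    case (union A)
    have A: "A i \<in> sets M" for i using G_M union(2) by blast
    show ?case
    proof (rule L1_approximable_limit[where s="\<lambda>k x. \<Sum>i<k. indicator (A i) x" and w="\<lambda>_. 1"])
      fix k show "L1_approximable (\<lambda>x. \<Sum>i<k. indicator (A i) x)"
      proof (induction k)
        case 0 show ?case by (auto intro!: L1_approximable_measurable[of _ 0])
      next
        case (Suc k)
        then have "L1_approximable (\<lambda>x. (\<Sum>i<k. indicator (A i) x) + indicator (A k) x)"
          using A union(3)[of k] by (intro L1_approximable_add Bochner_Integration.integrable_sum) auto
        then show ?case by simp
      qed
    next
      fix x
      have *: "(\<lambda>i. indicator (A i) x :: real) sums indicator (\<Union>i. A i) x"
        by (rule indicator_sums) (use union(1) in \<open>auto simp: disjoint_family_on_def\<close>)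
      then show "(\<lambda>k. \<Sum>i<k. indicator (A i) x) \<longlonglongrightarrow> (indicator (\<Union>i. A i) x :: real)"
        by (simp add: sums_def)
      fix k
      have "(\<Sum>i<k. indicator (A i) x) \<le> (indicator (\<Union>i. A i) x :: real)"
        unfolding sums_unique[OF *] by (intro sum_le_suminf sums_summable[OF *]) auto
      also have "\<dots> \<le> 1" by (simp add: indicator_def)
      finally have "(\<Sum>i<k. indicator (A i) x) \<le> (1::real)" .
      moreover have "0 \<le> (\<Sum>i<k. indicator (A i) x :: real)" by (intro sum_nonneg) simp
      ultimately show "\<bar>\<Sum>i<k. indicator (A i) x\<bar> \<le> (1::real)" by (simp only: abs_of_nonneg)
    qed (use A in auto)
  qed
qed

lemma L1_approximable_if_integrable:
  assumes "integrable M f" "f \<in> borel_measurable G"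
  shows "L1_approximable f"
proof -
  have "integrable (restr_to_subalg M G) f"
    using assms subalgebra_G by (auto intro: integrable_in_subalg)
  then show ?thesis
  proof (induction rule: integrable_induct)
    case (base A c)
    have "A \<in> sets G" using base by (simp add: sets_restr_to_subalg[OF subalgebra_G])
    moreover from this have "A \<in> sets M" using subalgebra_G by (auto simp: subalgebra_def)
    ultimately have "L1_approximable (\<lambda>x. c * indicator A x)"
      by (intro L1_approximable_cmult L1_approximable_indicator integrable_indicator_finite) auto
    then show ?case by (simp add: mult.commute)
  next
    case (add f g)
    then show ?case using integrable_from_subalg[OF subalgebra_G] by (intro L1_approximable_add) auto
  next
    case (lim f s)
    have "integrable M f" "integrable M (s i)" for i
      using lim integrable_from_subalg[OF subalgebra_G] by blast+
    then show ?case
      using lim by (intro L1_approximable_limit[of s f "\<lambda>x. 2 * norm (f x)"])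
        (auto simp: space_restr_to_subalg)
  qed
qed


text \<open>Replace \<open>f\<close> by \<open>h = E(f | G)\<close>, which has the same conditional expectations, and choose \<open>g\<close>
  measurable at time \<open>m\<close> and \<open>L\<^sup>1\<close>-close to \<open>h\<close>. For \<open>n \<ge> m\<close>, \<open>E(h | F n) - g\<close> is
  the conditional expectation of \<open>h - g\<close>. So where \<open>E(h | F n)\<close> and \<open>h\<close> keep differing by \<open>2 c\<close>,
  either \<open>\<bar>h - g\<bar>\<close> or some conditional expectation of it is at least \<open>c\<close>; both events are small by Markov's
  and Doob's inequalities.\<close>

lemma Levy_upward:
  assumes f: "integrable M f"
  shows "AE x in M. (\<lambda>n. real_cond_exp M (F n) f x) \<longlonglongrightarrow> real_cond_exp M G f x"
proof -
  interpret G: sigma_finite_subalgebra M G by (rule sigma_finite_subalgebra_G)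
  define h where "h = real_cond_exp M G f"
  have h_G: "h \<in> borel_measurable G" by (simp add: h_def)
  have h: "integrable M h" using f by (simp add: h_def G.real_cond_exp_int)
  have [measurable]: "h \<in> borel_measurable M" using h by simp
  have tower: "AE x in M. real_cond_exp M (F n) h x = real_cond_exp M (F n) f x" for n
  proof -
    interpret sigma_finite_subalgebra M "F n" by (rule sigma_finite_subalgebra_F)
    show ?thesis unfolding h_def
      by (rule real_cond_exp_nested_subalg[OF subalgebra_G subalgebra_G_F f])
  qed
  define bad where
    "bad c = {x\<in>space M. \<not> (\<exists>m. \<forall>n\<ge>m. \<bar>real_cond_exp M (F n) h x - h x\<bar> < c)}" for c :: real
  have [measurable]: "bad c \<in> sets M" for c unfolding bad_def by measurable
  have bad_small: "c * emeasure M (bad (2 * c)) \<le> 2 * ennreal e" if c: "0 < c" and e: "0 < e" for c e :: real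
  proof -
    obtain m g where g: "g \<in> borel_measurable (F m)" "integrable M g" "(\<integral>x. \<bar>h x - g x\<bar> \<partial>M) < e"
      using L1_approximable_if_integrable[OF h h_G] e unfolding L1_approximable_def by meson
    have [measurable]: "g \<in> borel_measurable M" using g by simp
    define r where "r x = ennreal \<bar>h x - g x\<bar>" for x
    have [measurable]: "r \<in> borel_measurable M" unfolding r_def by simp
    have r_le: "(\<integral>\<^sup>+x. r x \<partial>M) \<le> e"
      unfolding r_def using h g by (subst nn_integral_eq_integral) (auto simp: ennreal_leI)
    have "AE x in M. \<forall>n\<ge>m. \<bar>real_cond_exp M (F n) h x - g x\<bar> \<le> nn_cond_exp M (F n) r x"
    proof (subst AE_all_countable, intro allI)
      fix n
      interpret sigma_finite_subalgebra M "F n" by (rule sigma_finite_subalgebra_F)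
      show "AE x in M. m \<le> n \<longrightarrow> \<bar>real_cond_exp M (F n) h x - g x\<bar> \<le> nn_cond_exp M (F n) r x"
      proof (cases "m \<le> n")
        case True
        then have "g \<in> borel_measurable (F n)"
          using measurable_from_subalg[OF subalgebra_F_F g(1)] by auto
        then have "AE x in M. real_cond_exp M (F n) g x = g x"
          using g by (intro real_cond_exp_F_meas)
        moreover have "AE x in M. real_cond_exp M (F n) (\<lambda>x. h x - g x) x = real_cond_exp M (F n) h x - real_cond_exp M (F n) g x"
          using h g by (intro real_cond_exp_diff)
        moreover have "AE x in M. \<bar>real_cond_exp M (F n) (\<lambda>x. h x - g x) x\<bar> \<le> nn_cond_exp M (F n) r x"
          unfolding r_def by (intro real_cond_exp_abs) simp
        ultimately show ?thesis by eventually_elim auto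
      qed simp
    qed
    then have "AE x in M. x \<in> bad (2 * c) \<longrightarrow>
        x \<in> {x\<in>space M. \<exists>n. c \<le> nn_cond_exp M (F n) r x} \<union> {x\<in>space M. c \<le> r x}"
    proof eventually_elim
      case (elim x)
      show ?case
      proof
        assume x: "x \<in> bad (2 * c)"
        then obtain n where n: "m \<le> n" "2 * c \<le> \<bar>real_cond_exp M (F n) h x - h x\<bar>"
          by (auto simp: bad_def not_less)
        have "c \<le> \<bar>real_cond_exp M (F n) h x - g x\<bar> \<or> c \<le> \<bar>h x - g x\<bar>" using n(2) by linarith
        then have "ennreal c \<le> nn_cond_exp M (F n) r x \<or> ennreal c \<le> r x"
          using elim n(1) unfolding r_def by (meson ennreal_leI order_trans)
        then show "x \<in> {x\<in>space M. \<exists>n. c \<le> nn_cond_exp M (F n) r x} \<union> {x\<in>space M. c \<le> r x}"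
          using x by (auto simp: bad_def)
      qed
    qed
    then have "emeasure M (bad (2 * c))
        \<le> emeasure M ({x\<in>space M. \<exists>n. c \<le> nn_cond_exp M (F n) r x} \<union> {x\<in>space M. c \<le> r x})"
      by (intro emeasure_mono_AE) measurable
    also have "\<dots> \<le> emeasure M {x\<in>space M. \<exists>n. c \<le> nn_cond_exp M (F n) r x} + emeasure M {x\<in>space M. c \<le> r x}"
      by (intro emeasure_subadditive) measurable
    finally have "c * emeasure M (bad (2 * c)) \<le>
        c * emeasure M {x\<in>space M. \<exists>n. c \<le> nn_cond_exp M (F n) r x} + c * emeasure M {x\<in>space M. c \<le> r x}"
      by (simp add: distrib_left[symmetric] mult_left_mono)
    also have "\<dots> \<le> (\<integral>\<^sup>+x. r x \<partial>M) + (\<integral>\<^sup>+x. r x \<partial>M)"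
    proof (intro add_mono Doob_maximal_inequality)
      have "c * emeasure M {x\<in>space M. c \<le> r x} = (\<integral>\<^sup>+x. ennreal c * indicator {x\<in>space M. c \<le> r x} x \<partial>M)"
        by (subst nn_integral_cmult_indicator) auto
      also have "\<dots> \<le> (\<integral>\<^sup>+x. r x \<partial>M)"
        by (intro nn_integral_mono) (auto simp: indicator_def)
      finally show "c * emeasure M {x\<in>space M. c \<le> r x} \<le> (\<integral>\<^sup>+x. r x \<partial>M)" .
    qed simp
    also have "\<dots> \<le> 2 * ennreal e" using r_le by (simp add: mult_2 add_mono)
    finally show ?thesis .
  qed
  have null: "emeasure M (bad (2 * c)) = 0" if c: "0 < c" for c :: real
  proof -
    have "c * emeasure M (bad (2 * c)) \<le> 0"
    proof (rule ennreal_le_epsilon)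
      fix e :: real assume "0 < e"
      then show "c * emeasure M (bad (2 * c)) \<le> 0 + ennreal e"
        using bad_small[OF c, of "e/2"] by (simp add: ennreal_mult[symmetric, of 2, simplified])
    qed
    then show ?thesis using c by (simp add: ennreal_zero_less_mult_iff)
  qed
  have "AE x in M. \<forall>k. x \<notin> bad (2 * (1 / Suc k))"
    by (subst AE_all_countable, intro allI AE_not_in null_setsI null) auto
  moreover have "AE x in M. \<forall>n. real_cond_exp M (F n) h x = real_cond_exp M (F n) f x"
    using tower by (simp add: AE_all_countable)
  ultimately show ?thesis using AE_space
  proof eventually_elim
    case (elim x)
    have "(\<lambda>n. real_cond_exp M (F n) h x) \<longlonglongrightarrow> h x"
    proof (rule LIMSEQ_I)
      fix e :: real assume "0 < e"
      then obtain k where k: "1 / real (Suc k) < e / 2" using nat_approx_posE[of "e/2"] by auto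
      obtain m where m: "\<forall>n\<ge>m. \<bar>real_cond_exp M (F n) h x - h x\<bar> < 2 * (1 / real (Suc k))"
        using elim(1)[rule_format, of k] elim(3) unfolding bad_def by auto
      show "\<exists>m. \<forall>n\<ge>m. norm (real_cond_exp M (F n) h x - h x) < e"
      proof (intro exI allI impI)
        fix n assume "m \<le> n"
        then have "\<bar>real_cond_exp M (F n) h x - h x\<bar> < 2 * (1 / real (Suc k))" using m by blast
        then show "norm (real_cond_exp M (F n) h x - h x) < e" using k by simp
      qed
    qed
    then show ?case using elim(2) by (simp add: h_def)
  qed
qed

end

section \<open>Conditional dominated convergence and Cauchy-Schwarz\<close>

text \<open>The tail suprema \<open>D k\<close> of \<open>\<bar>f j - g\<bar>\<close>, \<open>j \<ge> k\<close>, decrease, and their integrals tend to 0. So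
  do their conditional expectations \<open>N k\<close>; being almost everywhere decreasing with integrals tending to 0, these
  tend to 0 almost everywhere, and they dominate the difference of the conditional expectations.\<close>

lemma (in sigma_finite_subalgebra) real_cond_exp_dominated_convergence:
  assumes f [measurable]: "\<And>k. f k \<in> borel_measurable M" "g \<in> borel_measurable M"
    and w: "integrable M w"
    and bound: "\<And>k. AE x in M. \<bar>f k x\<bar> \<le> w x"
    and lim: "AE x in M. (\<lambda>k. f k x) \<longlonglongrightarrow> g x"
  shows "AE x in M. (\<lambda>k. real_cond_exp M F (f k) x) \<longlonglongrightarrow> real_cond_exp M F g x"
proof -
  have [measurable]: "w \<in> borel_measurable M" using w by simp
  define D where "D k x = (SUP j. ennreal \<bar>f (k + j) x - g x\<bar>)" for k x
  have [measurable]: "D k \<in> borel_measurable M" for k unfolding D_def by measurable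
  define N where "N k = nn_cond_exp M F (D k)" for k
  have N_meas [measurable]: "N k \<in> borel_measurable F" "N k \<in> borel_measurable M" for k by (simp_all add: N_def)
  have bound': "AE x in M. \<forall>k. \<bar>f k x\<bar> \<le> w x" using bound by (simp add: AE_all_countable)
  have g_bound: "AE x in M. \<bar>g x\<bar> \<le> w x"
    using bound' lim
  proof eventually_elim
    case (elim x)
    then show ?case
      by (intro LIMSEQ_le_const2[OF tendsto_rabs[OF elim(2)]]) auto
  qed
  have f_int: "integrable M (f k)" for k
    by (rule Bochner_Integration.integrable_bound[OF w]) (use bound[of k] in auto)
  have g_int: "integrable M g"
    by (rule Bochner_Integration.integrable_bound[OF w]) (use g_bound in auto)
  have D_bound: "AE x in M. D k x \<le> ennreal \<bar>2 * w x\<bar>" for k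
    using bound' g_bound
  proof eventually_elim
    case (elim x)
    show ?case unfolding D_def
    proof (rule SUP_least, rule ennreal_leI)
      fix j show "\<bar>f (k + j) x - g x\<bar> \<le> \<bar>2 * w x\<bar>" using elim(1)[rule_format, of "k+j"] elim(2) by linarith
    qed
  qed
  have D_lim: "AE x in M. (\<lambda>k. D k x) \<longlonglongrightarrow> 0"
    using lim
  proof eventually_elim
    case (elim x)
    have "(\<lambda>k. ennreal \<bar>f k x - g x\<bar>) \<longlonglongrightarrow> 0"
      using tendsto_rabs[OF tendsto_diff[OF elim tendsto_const[of "g x"]]]
      by (subst tendsto_ennreal_iff[of _ _ 0, simplified]) auto
    show ?case
    proof (rule order_tendstoI)
      fix e :: ennreal assume "0 < e"
      then obtain e' where e': "0 < e'" "e' < e" using dense by blast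
      then obtain m where m: "\<And>k. m \<le> k \<Longrightarrow> ennreal \<bar>f k x - g x\<bar> < e'"
        using order_tendstoD(2)[OF \<open>(\<lambda>k. ennreal \<bar>f k x - g x\<bar>) \<longlonglongrightarrow> 0\<close> e'(1)]
        by (auto simp: eventually_sequentially)
      have "D k x < e" if "m \<le> k" for k
      proof -
        have "D k x \<le> e'" unfolding D_def using m that by (intro SUP_least less_imp_le) auto
        with e' show ?thesis by auto
      qed
      then show "eventually (\<lambda>k. D k x < e) sequentially" by (auto simp: eventually_sequentially)
    qed auto
  qed
  have "integrable M (\<lambda>x. 2 * w x)" using w by simp
  then have "(\<integral>\<^sup>+x. ennreal \<bar>2 * w x\<bar> \<partial>M) < \<infinity>"
    unfolding integrable_iff_bounded by (simp only: real_norm_def)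
  then have D_int: "(\<lambda>k. \<integral>\<^sup>+x. D k x \<partial>M) \<longlonglongrightarrow> (\<integral>\<^sup>+x. 0 \<partial>M)"
    by (intro nn_integral_dominated_convergence[where w="\<lambda>x. ennreal \<bar>2 * w x\<bar>"] D_bound D_lim) auto
  have N_int: "(\<integral>\<^sup>+x. N k x \<partial>M) = (\<integral>\<^sup>+x. D k x \<partial>M)" for k
    using nn_cond_exp_intg[of "\<lambda>_. 1" "D k"] by (simp add: N_def)
  have D_dec: "D (Suc k) x \<le> D k x" for k x
    unfolding D_def by (intro SUP_least SUP_upper2[of "Suc _"]) auto
  have N_dec: "AE x in M. \<forall>k. N (Suc k) x \<le> N k x"
    unfolding N_def by (subst AE_all_countable) (auto intro!: nn_cond_exp_mono simp: D_dec)
  have "(\<integral>\<^sup>+x. (INF k. N k x) \<partial>M) \<le> 0"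
  proof (rule LIMSEQ_le_const)
    show "(\<lambda>k. \<integral>\<^sup>+x. D k x \<partial>M) \<longlonglongrightarrow> 0" using D_int by simp
    show "\<exists>k0. \<forall>k\<ge>k0. (\<integral>\<^sup>+x. (INF k. N k x) \<partial>M) \<le> (\<integral>\<^sup>+x. D k x \<partial>M)"
      unfolding N_int[symmetric] by (auto intro!: nn_integral_mono INF_lower)
  qed
  then have "AE x in M. (INF k. N k x) = 0"
    by (subst nn_integral_0_iff_AE[symmetric]) auto
  moreover have "AE x in M. \<forall>k. \<bar>real_cond_exp M F (f k) x - real_cond_exp M F g x\<bar> \<le> N k x"
  proof (subst AE_all_countable, intro allI)
    fix k
    have "AE x in M. real_cond_exp M F (\<lambda>x. f k x - g x) x = real_cond_exp M F (f k) x - real_cond_exp M F g x"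
      using f_int g_int by (intro real_cond_exp_diff)
    moreover have "AE x in M. \<bar>real_cond_exp M F (\<lambda>x. f k x - g x) x\<bar> \<le> nn_cond_exp M F (\<lambda>x. ennreal \<bar>f k x - g x\<bar>) x"
      by (intro real_cond_exp_abs) simp
    moreover have "AE x in M. nn_cond_exp M F (\<lambda>x. ennreal \<bar>f k x - g x\<bar>) x \<le> N k x"
      unfolding N_def by (intro nn_cond_exp_mono) (auto simp: D_def intro!: SUP_upper2[of 0])
    ultimately show "AE x in M. \<bar>real_cond_exp M F (f k) x - real_cond_exp M F g x\<bar> \<le> N k x"
      by eventually_elim auto
  qed
  ultimately show ?thesis using N_dec
  proof eventually_elim
    case (elim x)
    have "decseq (\<lambda>k. N k x)" using elim(3) by (simp add: decseq_Suc_iff)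
    then have N0: "(\<lambda>k. N k x) \<longlonglongrightarrow> 0" using LIMSEQ_INF[of "\<lambda>k. N k x"] elim(1) by simp
    have "(\<lambda>k. ennreal \<bar>real_cond_exp M F (f k) x - real_cond_exp M F g x\<bar>) \<longlonglongrightarrow> 0"
      by (rule tendsto_sandwich[OF _ _ tendsto_const N0]) (use elim(2) in auto)
    then have "(\<lambda>k. \<bar>real_cond_exp M F (f k) x - real_cond_exp M F g x\<bar>) \<longlonglongrightarrow> 0"
      by (subst (asm) tendsto_ennreal_iff[of _ _ 0, simplified]) auto
    then show ?case by (simp add: LIM_zero_iff tendsto_rabs_zero_iff)
  qed
qed

text \<open>The usual discriminant argument. The quadratic inequality in \<open>t\<close> holds almost everywhere
  for each single \<open>t\<close>, hence simultaneously for all rational \<open>t\<close>, and by continuity for all real \<open>t\<close>.\<close>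

lemma (in sigma_finite_subalgebra) real_cond_exp_Cauchy_Schwarz:
  assumes f: "integrable M f" "\<And>x. 0 \<le> f x" and g: "integrable M g" "\<And>x. 0 \<le> g x"
  shows "AE x in M. (real_cond_exp M F (\<lambda>x. sqrt (f x * g x)) x)\<^sup>2
    \<le> real_cond_exp M F f x * real_cond_exp M F g x"
proof -
  have [measurable]: "f \<in> borel_measurable M" "g \<in> borel_measurable M" using f g by auto
  define s where "s x = sqrt (f x * g x)" for x
  have amgm: "2 * t * s x \<le> t\<^sup>2 * f x + g x" for t x
  proof -
    have "0 \<le> (t * sqrt (f x) - sqrt (g x))\<^sup>2" by simp
    also have "\<dots> = t\<^sup>2 * f x + g x - 2 * t * s x"
      using f(2) g(2) by (simp add: power2_diff power_mult_distrib s_def real_sqrt_mult)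
    finally show ?thesis by simp
  qed
  have s_pos: "0 \<le> s x" for x using f(2) g(2) by (simp add: s_def)
  have s: "integrable M s"
  proof (rule Bochner_Integration.integrable_bound[of _ "\<lambda>x. f x + g x"])
    show "AE x in M. norm (s x) \<le> norm (f x + g x)"
      using amgm[of 1] s_pos f(2) g(2) by (intro AE_I2) (auto, smt (verit))
  qed (use f g in \<open>auto simp: s_def[abs_def]\<close>)
  have "AE x in M. \<forall>t\<in>\<rat>. 2 * t * real_cond_exp M F s x \<le> t\<^sup>2 * real_cond_exp M F f x + real_cond_exp M F g x"
  proof (subst AE_ball_countable[OF countable_rat], intro ballI)
    fix t :: real
    have "AE x in M. real_cond_exp M F (\<lambda>x. 2 * t * s x) x \<le> real_cond_exp M F (\<lambda>x. t\<^sup>2 * f x + g x) x"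
      using amgm f g s by (intro real_cond_exp_mono) auto
    moreover have "AE x in M. real_cond_exp M F (\<lambda>x. 2 * t * s x) x = 2 * t * real_cond_exp M F s x"
      using s by (intro real_cond_exp_cmult)
    moreover have "AE x in M. real_cond_exp M F (\<lambda>x. t\<^sup>2 * f x) x = t\<^sup>2 * real_cond_exp M F f x"
      using f by (intro real_cond_exp_cmult)
    moreover have "AE x in M. real_cond_exp M F (\<lambda>x. t\<^sup>2 * f x + g x) x = real_cond_exp M F (\<lambda>x. t\<^sup>2 * f x) x + real_cond_exp M F g x"
      using f g by (intro real_cond_exp_add) auto
    ultimately show "AE x in M. 2 * t * real_cond_exp M F s x \<le> t\<^sup>2 * real_cond_exp M F f x + real_cond_exp M F g x"
      by eventually_elim simp
  qed
  moreover have "AE x in M. 0 \<le> real_cond_exp M F f x" "AE x in M. 0 \<le> real_cond_exp M F g x"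
    using f g by (auto intro: real_cond_exp_pos)
  ultimately have "AE x in M. (real_cond_exp M F s x)\<^sup>2 \<le> real_cond_exp M F f x * real_cond_exp M F g x"
  proof eventually_elim
    case (elim x)
    define a b h where "a = real_cond_exp M F f x" and "b = real_cond_exp M F g x" and "h = real_cond_exp M F s x"
    have ab: "0 \<le> a" "0 \<le> b" using elim by (auto simp: a_def b_def)
    have "closed {t. 2 * t * h \<le> t\<^sup>2 * a + b}"
      by (intro closed_Collect_le continuous_intros)
    moreover have "\<rat> \<subseteq> {t. 2 * t * h \<le> t\<^sup>2 * a + b}" using elim by (auto simp: a_def b_def h_def)
    ultimately have "closure \<rat> \<subseteq> {t. 2 * t * h \<le> t\<^sup>2 * a + b}" by (rule closure_minimal[rotated])
    then have all: "2 * t * h \<le> t\<^sup>2 * a + b" for t by (auto simp: Rats_closure_real)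
    have "h\<^sup>2 \<le> a * b"
    proof (cases "a = 0")
      case True
      have "h = 0"
      proof (rule ccontr)
        assume "h \<noteq> 0"
        then show False using all[of "(b + 1) / h"] ab True by simp
      qed
      then show ?thesis by (simp add: True)
    next
      case False
      then show ?thesis using all[of "h / a"] ab by (simp add: field_simps power2_eq_square)
    qed
    then show ?case by (simp add: a_def b_def h_def)
  qed
  then show ?thesis by (simp add: s_def[abs_def])
qed

section \<open>The limit of a ratio of conditional expectations\<close>

text \<open>A limit of the form 0/0. Since \<open>sqrt (f * g)\<close> vanishes with \<open>f\<close>, it does not change when \<open>g\<close> is
  replaced by \<open>b = g * 1{f > 0}\<close>. Conditional Cauchy-Schwarz then bounds the square of the ratio by
  \<open>E(b | F n) / E(g | F n)\<close>, and where \<open>f = 0 < g\<close> this tends to \<open>0 / g\<close>.\<close>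

lemma (in finite_filtration) affinity_ratio_vanishes:
  assumes f: "f \<in> borel_measurable G" "integrable M f" "\<And>x. 0 \<le> f x"
    and g: "g \<in> borel_measurable G" "integrable M g" "\<And>x. 0 \<le> g x"
  shows "AE x in M. f x = 0 \<and> 0 < g x \<longrightarrow>
    (\<lambda>n. real_cond_exp M (F n) (\<lambda>x. sqrt (f x * g x)) x /
       sqrt (real_cond_exp M (F n) f x * real_cond_exp M (F n) g x)) \<longlonglongrightarrow> 0"
proof -
  interpret G: sigma_finite_subalgebra M G by (rule sigma_finite_subalgebra_G)
  have [measurable]: "f \<in> borel_measurable M" "g \<in> borel_measurable M" using f g by auto
  define b where "b x = (if f x = 0 then 0 else g x)" for x
  have b_G: "b \<in> borel_measurable G" unfolding b_def using f(1) g(1) by measurable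
  have [measurable]: "b \<in> borel_measurable M" by (rule measurable_from_subalg[OF subalgebra_G b_G])
  have b: "integrable M b"
    by (rule Bochner_Integration.integrable_bound[OF g(2)]) (auto simp: b_def)
  have b_pos: "0 \<le> b x" for x using g(3) by (simp add: b_def)
  have fb: "sqrt (f x * g x) = sqrt (f x * b x)" for x by (simp add: b_def)
  have CS: "AE x in M. \<forall>n. (real_cond_exp M (F n) (\<lambda>x. sqrt (f x * g x)) x)\<^sup>2
      \<le> real_cond_exp M (F n) f x * real_cond_exp M (F n) b x"
    unfolding fb
  proof (subst AE_all_countable, intro allI)
    fix n
    interpret sigma_finite_subalgebra M "F n" by (rule sigma_finite_subalgebra_F)
    show "AE x in M. (real_cond_exp M (F n) (\<lambda>x. sqrt (f x * b x)) x)\<^sup>2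
      \<le> real_cond_exp M (F n) f x * real_cond_exp M (F n) b x"
      using f b b_pos by (intro real_cond_exp_Cauchy_Schwarz)
  qed
  have nonneg: "AE x in M. \<forall>n. 0 \<le> real_cond_exp M (F n) h x"
    if h: "integrable M h" "\<And>x. 0 \<le> h x" for h
  proof (subst AE_all_countable, intro allI)
    fix n
    interpret sigma_finite_subalgebra M "F n" by (rule sigma_finite_subalgebra_F)
    show "AE x in M. 0 \<le> real_cond_exp M (F n) h x" using h by (intro real_cond_exp_pos) auto
  qed
  note CS nonneg[OF f(2,3)]
  moreover have "AE x in M. real_cond_exp M G b x = b x" using b b_G by (intro G.real_cond_exp_F_meas)
  moreover have "AE x in M. real_cond_exp M G g x = g x" using g by (intro G.real_cond_exp_F_meas)
  ultimately show ?thesis using Levy_upward[OF b] Levy_upward[OF g(2)] nonneg[OF b b_pos]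
  proof eventually_elim
    case (elim x)
    show ?case
    proof
      assume x: "f x = 0 \<and> 0 < g x"
      let ?h = "\<lambda>n. real_cond_exp M (F n) (\<lambda>x. sqrt (f x * g x)) x"
      let ?f = "\<lambda>n. real_cond_exp M (F n) f x"
      let ?g = "\<lambda>n. real_cond_exp M (F n) g x"
      let ?b = "\<lambda>n. real_cond_exp M (F n) b x"
      have "?b \<longlonglongrightarrow> 0" using elim(3,5) x by (simp add: b_def)
      moreover have g_lim: "?g \<longlonglongrightarrow> g x" using elim(4,6) by simp
      ultimately have "(\<lambda>n. ?b n / ?g n) \<longlonglongrightarrow> 0 / g x" using x by (intro tendsto_divide) auto
      then have bound: "(\<lambda>n. ?b n / ?g n) \<longlonglongrightarrow> 0" by simp
      have "(\<lambda>n. (?h n / sqrt (?f n * ?g n))\<^sup>2) \<longlonglongrightarrow> 0"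
      proof (rule tendsto_sandwich[OF _ _ tendsto_const bound])
        have ratio: "(?h n / sqrt (?f n * ?g n))\<^sup>2 \<le> ?b n / ?g n" if gn: "0 < ?g n" for n
        proof (cases "?f n = 0")
          \<comment> \<open>Division by zero makes the ratio 0 here.\<close>
          case True
          then show ?thesis using elim(7) gn by simp
        next
          case False
          then have "0 < ?f n" using elim(2) by (simp add: less_le)
          then have "(?h n / sqrt (?f n * ?g n))\<^sup>2 = (?h n)\<^sup>2 / (?f n * ?g n)"
            using gn by (simp add: power_divide)
          also have "\<dots> \<le> (?f n * ?b n) / (?f n * ?g n)"
            using elim(1) gn \<open>0 < ?f n\<close> by (intro divide_right_mono) auto
          also have "\<dots> = ?b n / ?g n" using \<open>0 < ?f n\<close> by simp
          finally show ?thesis .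
        qed
        show "eventually (\<lambda>n. (?h n / sqrt (?f n * ?g n))\<^sup>2 \<le> ?b n / ?g n) sequentially"
          using x by (intro eventually_mono[OF order_tendstoD(1)[OF g_lim] ratio]) auto
      qed simp
      then have "(\<lambda>n. sqrt ((?h n / sqrt (?f n * ?g n))\<^sup>2)) \<longlonglongrightarrow> sqrt 0" by (rule tendsto_real_sqrt)
      then show "(\<lambda>n. ?h n / sqrt (?f n * ?g n)) \<longlonglongrightarrow> 0"
        by (simp only: real_sqrt_abs real_sqrt_zero tendsto_rabs_zero_iff)
    qed
  qed
qed

text \<open>Where \<open>f\<close> and \<open>g\<close> are both positive, Levy's theorem gives the limit \<open>sqrt (f * g) / sqrt (f * g)\<close>;
  where exactly one of them vanishes, the previous lemma applies, possibly with \<open>f\<close> and \<open>g\<close> exchanged.\<close>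

lemma (in finite_filtration) affinity_ratio_limit:
  assumes f: "f \<in> borel_measurable G" "integrable M f" "\<And>x. 0 \<le> f x"
    and g: "g \<in> borel_measurable G" "integrable M g" "\<And>x. 0 \<le> g x"
  shows "AE x in M. 0 < f x \<or> 0 < g x \<longrightarrow>
    (\<lambda>n. real_cond_exp M (F n) (\<lambda>x. sqrt (f x * g x)) x /
       sqrt (real_cond_exp M (F n) f x * real_cond_exp M (F n) g x))
      \<longlonglongrightarrow> of_bool (0 < f x \<and> 0 < g x)"
proof -
  interpret G: sigma_finite_subalgebra M G by (rule sigma_finite_subalgebra_G)
  have [measurable]: "f \<in> borel_measurable M" "g \<in> borel_measurable M" using f g by auto
  define z where "z x = sqrt (f x * g x)" for x
  have z_G: "z \<in> borel_measurable G" unfolding z_def using f(1) g(1) by measurable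
  have [measurable]: "z \<in> borel_measurable M" by (rule measurable_from_subalg[OF subalgebra_G z_G])
  have z: "integrable M z"
  proof (rule Bochner_Integration.integrable_bound[of _ "\<lambda>x. f x + g x"])
    show "AE x in M. norm (z x) \<le> norm (f x + g x)"
    proof (rule AE_I2)
      fix x
      have "sqrt (f x * g x) \<le> (f x + g x) / 2" using f(3) g(3) by (intro arith_geo_mean_sqrt)
      then show "norm (z x) \<le> norm (f x + g x)" using f(3)[of x] g(3)[of x] by (simp add: z_def)
    qed
  qed (use f g in auto)
  have "AE x in M. real_cond_exp M G z x = z x" using z z_G by (intro G.real_cond_exp_F_meas)
  moreover have "AE x in M. real_cond_exp M G f x = f x" using f by (intro G.real_cond_exp_F_meas)
  moreover have "AE x in M. real_cond_exp M G g x = g x" using g by (intro G.real_cond_exp_F_meas)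
  ultimately show ?thesis
    using Levy_upward[OF z] Levy_upward[OF f(2)] Levy_upward[OF g(2)]
      affinity_ratio_vanishes[OF f g] affinity_ratio_vanishes[OF g f]
    unfolding z_def[symmetric, abs_def]
  proof eventually_elim
    case (elim x)
    consider "f x = 0 \<and> g x = 0" | "f x = 0 \<and> 0 < g x" | "g x = 0 \<and> 0 < f x" | "0 < f x \<and> 0 < g x"
      using f(3)[of x] g(3)[of x] by (auto simp: less_le)
    then show ?case
    proof cases
      case 2
      then show ?thesis using elim(7) by simp
    next
      case 3
      have "(\<lambda>x. sqrt (g x * f x)) = z" by (simp add: z_def mult.commute fun_eq_iff)
      then show ?thesis using elim(8) 3 by (simp add: mult.commute)
    next
      case 4
      have "(\<lambda>n. real_cond_exp M (F n) z x / sqrt (real_cond_exp M (F n) f x * real_cond_exp M (F n) g x))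
          \<longlonglongrightarrow> z x / sqrt (f x * g x)"
        using elim 4 by (intro tendsto_intros) auto
      moreover have "(\<lambda>x. sqrt (f x * g x)) = z" by (simp add: z_def fun_eq_iff)
      ultimately show ?thesis using 4 by (simp add: z_def)
    qed simp
  qed
qed

section \<open>Two probability measures with densities summing to one\<close>

lemma nn_set_integral_eq_set_integral:
  fixes g :: "'a \<Rightarrow> real"
  assumes "B \<in> sets M" "integrable M g" "AE x in M. 0 \<le> g x"
  shows "(\<integral>\<^sup>+x. ennreal (g x) * indicator B x \<partial>M) = ennreal (\<integral>x\<in>B. g x \<partial>M)"
proof -
  have "(\<integral>\<^sup>+x. ennreal (g x) * indicator B x \<partial>M) = (\<integral>\<^sup>+x. ennreal (indicator B x *\<^sub>R g x) \<partial>M)"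
    by (intro nn_integral_cong) (simp add: indicator_def)
  also have "\<dots> = ennreal (\<integral>x. indicator B x *\<^sub>R g x \<partial>M)"
  proof (rule nn_integral_eq_integral)
    show "integrable M (\<lambda>x. indicator B x *\<^sub>R g x)"
      using assms by (intro integrable_mult_indicator)
    show "AE x in M. 0 \<le> indicator B x *\<^sub>R g x"
      using assms(3) by eventually_elim simp
  qed
  finally show ?thesis by (simp add: set_lebesgue_integral_def)
qed

lemma set_integral_nonneg_AE:
  fixes g :: "'a \<Rightarrow> real"
  assumes "AE x in M. 0 \<le> g x"
  shows "0 \<le> (\<integral>x\<in>B. g x \<partial>M)"
  unfolding set_lebesgue_integral_def
  by (intro integral_nonneg_AE, use assms in eventually_elim) simp

text \<open>The density \<open>d\<close> is bounded by 0 and 1 everywhere, not only almost everywhere: \<open>d\<close> and \<open>1 - d\<close> then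
  enter integrals and conditional expectations without exceptional sets.\<close>

locale dominated_pair = finite_measure S for S :: "'a measure" +
  fixes d :: "'a \<Rightarrow> real" and P P' :: "'a measure"
  assumes d_meas [measurable]: "d \<in> borel_measurable S"
    and d_ge_0: "\<And>x. 0 \<le> d x" and d_le_1: "\<And>x. d x \<le> 1"
    and P_eq: "P = density S (\<lambda>x. ennreal (d x))"
    and P'_eq: "P' = density S (\<lambda>x. ennreal (1 - d x))"
    and prob_P: "prob_space P" and prob_P': "prob_space P'"
begin

lemma sets_P [simp, measurable_cong]: "sets P = sets S" and space_P [simp]: "space P = space S"
  and sets_P' [simp, measurable_cong]: "sets P' = sets S" and space_P' [simp]: "space P' = space S"
  by (simp_all add: P_eq P'_eq)

sublocale P: prob_space P by (rule prob_P)
sublocale P': prob_space P' by (rule prob_P')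

lemma integrable_P_iff: "f \<in> borel_measurable S \<Longrightarrow> integrable P f \<longleftrightarrow> integrable S (\<lambda>x. f x * d x)" for f :: "'a \<Rightarrow> real"
  unfolding P_eq using d_ge_0 by (subst integrable_real_density) (auto simp: mult.commute)

lemma integral_P: "f \<in> borel_measurable S \<Longrightarrow> (\<integral>x. f x \<partial>P) = (\<integral>x. f x * d x \<partial>S)" for f :: "'a \<Rightarrow> real"
  unfolding P_eq using d_ge_0 by (subst integral_real_density) (auto simp: mult.commute)

lemma integrable_d: "integrable S d"
  by (rule integrable_const_bound[of _ 1]) (use d_ge_0 d_le_1 in auto)

lemma sigma_finite_subalgebra_S: "subalgebra S G \<Longrightarrow> sigma_finite_subalgebra S G"
  by (intro finite_measure_subalgebra_is_sigma_finite) (unfold_locales)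

lemma sigma_finite_subalgebra_P: "subalgebra S G \<Longrightarrow> sigma_finite_subalgebra P G"
  by (intro finite_measure_subalgebra_is_sigma_finite finite_measure_subalgebra.intro P.finite_measure_axioms)
    (simp add: finite_measure_subalgebra_axioms_def subalgebra_def)

lemma AE_P_if_AE_S: "(AE x in S. Q x) \<Longrightarrow> AE x in P. Q x"
  unfolding P_eq by (subst AE_density) auto

text \<open>Over a set in \<open>G\<close>, \<open>f\<close> and \<open>E_P(f | G)\<close> have the same integral under \<open>P\<close>, that is, \<open>f d\<close>
  and \<open>E_P(f | G) d\<close> have the same integral under \<open>S\<close>. In \<open>E_S(E_P(f | G) d | G)\<close> the first factor can be
  taken out. The identity holds \<open>S\<close>-almost everywhere, although \<open>E_P\<close> refers to \<open>P\<close> alone; this is how statements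
  about \<open>P\<close>-conditional expectations become statements about both measures.\<close>

lemma Bayes_formula:
  assumes G: "subalgebra S G" and f: "integrable P f"
  shows "AE x in S. real_cond_exp P G f x * real_cond_exp S G d x = real_cond_exp S G (\<lambda>x. f x * d x) x"
proof -
  interpret SG: sigma_finite_subalgebra S G by (rule sigma_finite_subalgebra_S[OF G])
  interpret PG: sigma_finite_subalgebra P G by (rule sigma_finite_subalgebra_P[OF G])
  have G_S: "B \<in> sets S" if "B \<in> sets G" for B using G that by (auto simp: subalgebra_def)
  define e where "e = real_cond_exp P G f"
  have e_G: "e \<in> borel_measurable G" by (simp add: e_def)
  have [measurable]: "f \<in> borel_measurable S" using borel_measurable_integrable[OF f] by (simp add: P_eq)
  have [measurable]: "e \<in> borel_measurable S" by (rule measurable_from_subalg[OF G e_G])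
  have e: "integrable P e" unfolding e_def by (rule PG.real_cond_exp_int(1)[OF f])
  have ed: "integrable S (\<lambda>x. e x * d x)" and fd: "integrable S (\<lambda>x. f x * d x)"
    using e f by (simp_all add: integrable_P_iff)
  have e_mult: "AE x in S. real_cond_exp S G (\<lambda>x. e x * d x) x = e x * real_cond_exp S G d x"
    using ed e_G by (intro SG.real_cond_exp_mult) auto
  have "AE x in S. real_cond_exp S G (\<lambda>x. f x * d x) x = real_cond_exp S G (\<lambda>x. e x * d x) x"
  proof (rule SG.real_cond_exp_charact)
    fix B assume B: "B \<in> sets G"
    have [measurable]: "B \<in> sets S" using G_S[OF B] .
    have "(\<integral>x\<in>B. f x * d x \<partial>S) = (\<integral>x\<in>B. f x \<partial>P)"
      unfolding set_lebesgue_integral_def by (subst integral_P) (auto simp: mult.assoc)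
    also have "\<dots> = (\<integral>x\<in>B. e x \<partial>P)" unfolding e_def by (rule PG.real_cond_exp_intA[OF f B])
    also have "\<dots> = (\<integral>x\<in>B. e x * d x \<partial>S)"
      unfolding set_lebesgue_integral_def by (subst integral_P) (auto simp: mult.assoc)
    also have "\<dots> = (\<integral>x\<in>B. real_cond_exp S G (\<lambda>x. e x * d x) x \<partial>S)"
      by (rule SG.real_cond_exp_intA[OF ed B])
    finally show "(\<integral>x\<in>B. f x * d x \<partial>S) = (\<integral>x\<in>B. real_cond_exp S G (\<lambda>x. e x * d x) x \<partial>S)" .
  qed (use fd SG.real_cond_exp_int[OF ed] in auto)
  with e_mult show ?thesis unfolding e_def[symmetric] by eventually_elim simp
qed

lemma cond_density_bounds:
  assumes "subalgebra S G"
  shows "AE x in S. 0 \<le> real_cond_exp S G d x \<and> real_cond_exp S G d x \<le> 1"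
proof -
  interpret SG: sigma_finite_subalgebra S G by (rule sigma_finite_subalgebra_S[OF assms])
  have "AE x in S. 0 \<le> real_cond_exp S G d x"
    by (rule SG.real_cond_exp_ge_c[OF integrable_d]) (simp add: d_ge_0)
  moreover have "AE x in S. real_cond_exp S G d x \<le> 1"
    by (rule SG.real_cond_exp_le_c[OF integrable_d]) (simp add: d_le_1)
  ultimately show ?thesis by eventually_elim simp
qed

text \<open>\<open>L\<close> is a version of the derivative of \<open>P'\<close> with respect to \<open>P\<close> on the \<open>\<sigma>\<close>-algebra \<open>G\<close>.
  Nonnegativity is required on the space only, because functions of restricted coordinate families
  are not controlled outside the product space.\<close>

definition derivative_on :: "'a measure \<Rightarrow> ('a \<Rightarrow> real) \<Rightarrow> bool" where
  "derivative_on G L \<longleftrightarrow> L \<in> borel_measurable G \<and> (\<forall>x\<in>space S. 0 \<le> L x) \<and>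
     (\<forall>B\<in>sets G. emeasure P' B = (\<integral>\<^sup>+x. ennreal (L x) * indicator B x \<partial>P))"

lemma derivative_on_nn_integral:
  assumes G: "subalgebra S G" and L: "derivative_on G L" and f: "f \<in> borel_measurable G"
  shows "(\<integral>\<^sup>+x. f x \<partial>P') = (\<integral>\<^sup>+x. ennreal (L x) * f x \<partial>P)"
proof -
  have GP: "subalgebra P G" "subalgebra P' G" using G by (auto simp: subalgebra_def)
  have L_G: "L \<in> borel_measurable G" using L by (simp add: derivative_on_def)
  have L_R: "(\<lambda>x. ennreal (L x)) \<in> borel_measurable (restr_to_subalg P G)"
    by (rule measurable_in_subalg[OF GP(1)]) (use L_G in measurable)
  have f_R: "f \<in> borel_measurable (restr_to_subalg P G)"
    by (rule measurable_in_subalg[OF GP(1) f])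
  have "restr_to_subalg P' G = density (restr_to_subalg P G) (\<lambda>x. ennreal (L x))"
  proof (rule measure_eqI)
    show "sets (restr_to_subalg P' G) = sets (density (restr_to_subalg P G) (\<lambda>x. ennreal (L x)))"
      by (simp add: sets_restr_to_subalg[OF GP(1)] sets_restr_to_subalg[OF GP(2)])
    fix B assume "B \<in> sets (restr_to_subalg P' G)"
    then have B: "B \<in> sets G" by (simp only: sets_restr_to_subalg[OF GP(2)])
    have LB: "(\<lambda>x. ennreal (L x) * indicator B x) \<in> borel_measurable G"
      using L_G B by measurable
    have "emeasure (density (restr_to_subalg P G) (\<lambda>x. ennreal (L x))) B =
        (\<integral>\<^sup>+x. ennreal (L x) * indicator B x \<partial>restr_to_subalg P G)"
      using B by (intro emeasure_density L_R) (simp only: sets_restr_to_subalg[OF GP(1)])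
    also have "\<dots> = (\<integral>\<^sup>+x. ennreal (L x) * indicator B x \<partial>P)"
      by (rule nn_integral_subalgebra2[OF GP(1) LB])
    also have "\<dots> = emeasure P' B" using L B by (simp add: derivative_on_def)
    finally show "emeasure (restr_to_subalg P' G) B = emeasure (density (restr_to_subalg P G) (\<lambda>x. ennreal (L x))) B"
      by (simp only: emeasure_restr_to_subalg[OF GP(2) B])
  qed
  then have "(\<integral>\<^sup>+x. f x \<partial>restr_to_subalg P' G) = (\<integral>\<^sup>+x. ennreal (L x) * f x \<partial>restr_to_subalg P G)"
    using L_R f_R by (simp only: nn_integral_density)
  moreover have "(\<lambda>x. ennreal (L x) * f x) \<in> borel_measurable G"
    using L_G f by measurable
  ultimately show ?thesis
    using f by (simp only: nn_integral_subalgebra2[OF GP(1)] nn_integral_subalgebra2[OF GP(2)])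
qed

lemma derivative_on_integral_1:
  assumes "subalgebra S G" "derivative_on G L"
  shows "(\<integral>\<^sup>+x. ennreal (L x) \<partial>P) = 1"
  using derivative_on_nn_integral[OF assms, of "\<lambda>_. 1"] P'.emeasure_space_1 by simp

lemma derivative_on_integrable:
  assumes G: "subalgebra S G" and L: "derivative_on G L"
  shows "integrable P L"
proof (rule integrableI_nonneg)
  have "L \<in> borel_measurable G" using L by (simp add: derivative_on_def)
  from measurable_from_subalg[OF G this] show "L \<in> borel_measurable P" by (simp add: P_eq)
  show "AE x in P. 0 \<le> L x" using L by (intro AE_I2) (auto simp: derivative_on_def)
qed (simp add: derivative_on_integral_1[OF assms])

text \<open>Both sides are versions of \<open>E_S(1 - d | G)\<close>: the right side by linearity, the left side because
  \<open>L d\<close> and \<open>1 - d\<close> both integrate to \<open>P' B\<close> over every \<open>B\<close> in \<open>G\<close>.\<close>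

lemma derivative_on_times_cond_density:
  assumes G: "subalgebra S G" and L: "derivative_on G L"
  shows "AE x in S. L x * real_cond_exp S G d x = 1 - real_cond_exp S G d x"
proof -
  interpret SG: sigma_finite_subalgebra S G by (rule sigma_finite_subalgebra_S[OF G])
  have G_S: "B \<in> sets S" if "B \<in> sets G" for B using G that by (auto simp: subalgebra_def)
  have L_G: "L \<in> borel_measurable G" using L by (simp add: derivative_on_def)
  have [measurable]: "L \<in> borel_measurable S" by (rule measurable_from_subalg[OF G L_G])
  have L_P: "integrable P L" by (rule derivative_on_integrable[OF G L])
  then have Ld: "integrable S (\<lambda>x. L x * d x)" by (simp add: integrable_P_iff)
  have one: "integrable S (\<lambda>_. 1 :: real)" by simp
  have d1: "integrable S (\<lambda>x. 1 - d x)" using integrable_d by simp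
  have "AE x in S. real_cond_exp S G (\<lambda>x. 1 - d x) x = real_cond_exp S G (\<lambda>x. L x * d x) x"
  proof (rule SG.real_cond_exp_charact)
    fix B assume B: "B \<in> sets G"
    have [measurable]: "B \<in> sets S" using G_S[OF B] .
    have L_pos: "AE x in P. 0 \<le> L x" using L by (intro AE_I2) (simp add: derivative_on_def)
    have d_pos: "AE x in S. 0 \<le> 1 - d x" using d_le_1 by simp
    have "ennreal (\<integral>x\<in>B. 1 - d x \<partial>S) = (\<integral>\<^sup>+x. ennreal (1 - d x) * indicator B x \<partial>S)"
      by (rule nn_set_integral_eq_set_integral[OF _ d1 d_pos, symmetric]) fact
    also have "\<dots> = emeasure P' B" unfolding P'_eq by (subst emeasure_density) auto
    also have "\<dots> = (\<integral>\<^sup>+x. ennreal (L x) * indicator B x \<partial>P)" using L B by (simp add: derivative_on_def)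
    also have "\<dots> = ennreal (\<integral>x\<in>B. L x \<partial>P)"
      by (rule nn_set_integral_eq_set_integral[OF _ L_P L_pos]) simp
    finally have "(\<integral>x\<in>B. 1 - d x \<partial>S) = (\<integral>x\<in>B. L x \<partial>P)"
      using set_integral_nonneg_AE[OF d_pos] set_integral_nonneg_AE[OF L_pos]
      by (simp only: ennreal_inj)
    also have "\<dots> = (\<integral>x\<in>B. L x * d x \<partial>S)"
      unfolding set_lebesgue_integral_def by (subst integral_P) (auto simp: mult.assoc)
    also have "\<dots> = (\<integral>x\<in>B. real_cond_exp S G (\<lambda>x. L x * d x) x \<partial>S)" by (rule SG.real_cond_exp_intA[OF Ld B])
    finally show "(\<integral>x\<in>B. 1 - d x \<partial>S) = (\<integral>x\<in>B. real_cond_exp S G (\<lambda>x. L x * d x) x \<partial>S)" .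
  qed (use d1 SG.real_cond_exp_int[OF Ld] in auto)
  moreover have "AE x in S. real_cond_exp S G (\<lambda>x. L x * d x) x = L x * real_cond_exp S G d x"
    using Ld L_G by (intro SG.real_cond_exp_mult) auto
  moreover have "AE x in S. real_cond_exp S G (\<lambda>x. 1 - d x) x = real_cond_exp S G (\<lambda>_. 1) x - real_cond_exp S G d x"
    using one integrable_d by (intro SG.real_cond_exp_diff)
  moreover have "AE x in S. real_cond_exp S G (\<lambda>_. 1 :: real) x = 1"
    using one by (intro SG.real_cond_exp_F_meas) auto
  ultimately show ?thesis by eventually_elim (simp only:)
qed

lemma cond_density_strict:
  assumes G: "subalgebra S G" and L: "derivative_on G L" and pos: "\<And>x. x \<in> space S \<Longrightarrow> 0 < L x"
  shows "AE x in S. 0 < real_cond_exp S G d x \<and> real_cond_exp S G d x < 1"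
  using derivative_on_times_cond_density[OF G L] cond_density_bounds[OF G] AE_space
proof eventually_elim
  case (elim x)
  from elim(1) pos[OF elim(3)] have "real_cond_exp S G d x \<noteq> 0" "real_cond_exp S G d x \<noteq> 1" by auto
  with elim(2) show ?case by simp
qed

text \<open>On \<open>G\<close> the densities of \<open>P\<close> and \<open>P'\<close> with respect to \<open>S\<close> are \<open>y = E_S(d | G)\<close> and \<open>1 - y\<close>.
  Hence \<open>B\<close> is \<open>P\<close>-null iff \<open>y = 0\<close> almost everywhere on \<open>B\<close>, and \<open>P'\<close>-null iff \<open>y = 1\<close>
  almost everywhere on \<open>B\<close>. For the forward direction, the sets where \<open>y \<le> 0\<close> and where \<open>y \<ge> 1\<close> are the ones to test.\<close>

lemma equivalent_iff_cond_density_strict: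
  assumes G: "subalgebra S G"
  shows "(\<forall>B\<in>sets G. emeasure P B = 0 \<longleftrightarrow> emeasure P' B = 0) \<longleftrightarrow>
    (AE x in S. 0 < real_cond_exp S G d x \<and> real_cond_exp S G d x < 1)"
proof -
  interpret SG: sigma_finite_subalgebra S G by (rule sigma_finite_subalgebra_S[OF G])
  define y where "y = real_cond_exp S G d"
  have y_G [measurable]: "y \<in> borel_measurable G" by (simp add: y_def)
  have [measurable]: "y \<in> borel_measurable S" by (rule measurable_from_subalg[OF G y_G])
  have G_S: "B \<in> sets S" if "B \<in> sets G" for B using G that by (auto simp: subalgebra_def)
  have space_G: "space G = space S" using G by (simp add: subalgebra_def)
  have y01: "AE x in S. 0 \<le> y x \<and> y x \<le> 1" unfolding y_def by (rule cond_density_bounds[OF G])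
  have y: "integrable S y" unfolding y_def by (rule SG.real_cond_exp_int(1)[OF integrable_d])
  have y1: "integrable S (\<lambda>x. 1 - y x)" and d1: "integrable S (\<lambda>x. 1 - d x)"
    using y integrable_d by auto
  have y_pos: "AE x in S. 0 \<le> y x" "AE x in S. 0 \<le> 1 - y x"
    using y01 by (eventually_elim, simp)+
  have d_pos: "AE x in S. 0 \<le> d x" "AE x in S. 0 \<le> 1 - d x"
    using d_ge_0 d_le_1 by simp_all
  have int_eq: "(\<integral>x\<in>B. d x \<partial>S) = (\<integral>x\<in>B. y x \<partial>S)" if "B \<in> sets G" for B
    unfolding y_def by (rule SG.real_cond_exp_intA[OF integrable_d that])
  have P_B: "emeasure P B = (\<integral>\<^sup>+x. ennreal (y x) * indicator B x \<partial>S)" if B: "B \<in> sets G" for B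
    unfolding nn_set_integral_eq_set_integral[OF G_S[OF B] y y_pos(1)] int_eq[OF B, symmetric]
      nn_set_integral_eq_set_integral[OF G_S[OF B] integrable_d d_pos(1), symmetric] P_eq
    using G_S[OF B] by (subst emeasure_density) auto
  have int_eq': "(\<integral>x\<in>B. 1 - d x \<partial>S) = (\<integral>x\<in>B. 1 - y x \<partial>S)" if B: "B \<in> sets G" for B
  proof -
    have "set_integrable S B (\<lambda>_. 1 :: real)" "set_integrable S B d" "set_integrable S B y"
      unfolding set_integrable_def using G_S[OF B] y integrable_d
      by (auto intro!: integrable_mult_indicator simp del: real_scaleR_def)
    then show ?thesis using int_eq[OF B] by (simp only: set_integral_diff)
  qed
  have P'_B: "emeasure P' B = (\<integral>\<^sup>+x. ennreal (1 - y x) * indicator B x \<partial>S)" if B: "B \<in> sets G" for B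
    unfolding nn_set_integral_eq_set_integral[OF G_S[OF B] y1 y_pos(2)] int_eq'[OF B, symmetric]
      nn_set_integral_eq_set_integral[OF G_S[OF B] d1 d_pos(2), symmetric] P'_eq
    using G_S[OF B] by (subst emeasure_density) auto
  have P_null: "emeasure P B = 0 \<longleftrightarrow> (AE x in S. x \<in> B \<longrightarrow> y x \<le> 0)"
    and P'_null: "emeasure P' B = 0 \<longleftrightarrow> (AE x in S. x \<in> B \<longrightarrow> 1 \<le> y x)" if B: "B \<in> sets G" for B
  proof -
    have [measurable]: "B \<in> sets S" using G_S[OF B] .
    have *: "ennreal t * indicator B x = 0 \<longleftrightarrow> (x \<in> B \<longrightarrow> t \<le> 0)" for t x
      by (auto simp: indicator_def ennreal_eq_0_iff)
    have "emeasure P B = 0 \<longleftrightarrow> (AE x in S. ennreal (y x) * indicator B x = 0)"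
      unfolding P_B[OF B] by (rule nn_integral_0_iff_AE) measurable
    then show "emeasure P B = 0 \<longleftrightarrow> (AE x in S. x \<in> B \<longrightarrow> y x \<le> 0)" unfolding * .
    have "emeasure P' B = 0 \<longleftrightarrow> (AE x in S. ennreal (1 - y x) * indicator B x = 0)"
      unfolding P'_B[OF B] by (rule nn_integral_0_iff_AE) measurable
    then show "emeasure P' B = 0 \<longleftrightarrow> (AE x in S. x \<in> B \<longrightarrow> 1 \<le> y x)" unfolding * by simp
  qed
  show ?thesis unfolding y_def[symmetric]
  proof
    assume eqv: "\<forall>B\<in>sets G. emeasure P B = 0 \<longleftrightarrow> emeasure P' B = 0"
    have B0: "{x\<in>space S. y x \<le> 0} \<in> sets G" and B1: "{x\<in>space S. 1 \<le> y x} \<in> sets G"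
      unfolding space_G[symmetric] by measurable
    have "AE x in S. x \<in> {x\<in>space S. y x \<le> 0} \<longrightarrow> 1 \<le> y x"
    proof -
      have "AE x in S. x \<in> {x\<in>space S. y x \<le> 0} \<longrightarrow> y x \<le> 0" by (rule AE_I2) blast
      then have "emeasure P {x\<in>space S. y x \<le> 0} = 0" unfolding P_null[OF B0] .
      then show ?thesis using eqv B0 P'_null[OF B0] by blast
    qed
    moreover have "AE x in S. x \<in> {x\<in>space S. 1 \<le> y x} \<longrightarrow> y x \<le> 0"
    proof -
      have "AE x in S. x \<in> {x\<in>space S. 1 \<le> y x} \<longrightarrow> 1 \<le> y x" by (rule AE_I2) blast
      then have "emeasure P' {x\<in>space S. 1 \<le> y x} = 0" unfolding P'_null[OF B1] .
      then show ?thesis using eqv B1 P_null[OF B1] by blast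
    qed
    ultimately show "AE x in S. 0 < y x \<and> y x < 1"
      using AE_space
    proof eventually_elim
      case (elim x)
      then have "y x \<le> 0 \<longrightarrow> 1 \<le> y x" "1 \<le> y x \<longrightarrow> y x \<le> 0" by blast+
      then show ?case by linarith
    qed
  next
    assume strict: "AE x in S. 0 < y x \<and> y x < 1"
    show "\<forall>B\<in>sets G. emeasure P B = 0 \<longleftrightarrow> emeasure P' B = 0"
    proof
      fix B assume B: "B \<in> sets G"
      have "(AE x in S. x \<in> B \<longrightarrow> y x \<le> 0) \<longleftrightarrow> (AE x in S. x \<in> B \<longrightarrow> 1 \<le> y x)"
        by (intro eventually_cong eventually_mono[OF strict]) auto
      then show "emeasure P B = 0 \<longleftrightarrow> emeasure P' B = 0" by (simp add: P_null[OF B] P'_null[OF B])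
    qed
  qed
qed

end

section \<open>The iterated limit of conditional affinities\<close>

text \<open>Equality holds everywhere, since the conditional expectation is chosen as a function of the
  measures whose densities are the positive parts of \<open>f\<close> and \<open>-f\<close>. So no \<open>P\<close>-null set has to be compared with the null sets of another measure.\<close>

lemma real_cond_exp_eq_if_AE_eq:
  assumes "AE x in M. f x = g x" and [measurable]: "f \<in> borel_measurable M" "g \<in> borel_measurable M"
  shows "real_cond_exp M F f = real_cond_exp M F g"
proof -
  have "density M (\<lambda>x. ennreal (f x)) = density M (\<lambda>x. ennreal (g x))"
    "density M (\<lambda>x. ennreal (- f x)) = density M (\<lambda>x. ennreal (- g x))"
    using assms(1) by (intro density_cong, simp, simp, eventually_elim, simp)+
  then show ?thesis by (simp add: real_cond_exp_def nn_cond_exp_def)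
qed

lemma sqrt_diff_squared_le:
  fixes a b :: real
  assumes "0 \<le> a" "0 \<le> b"
  shows "(sqrt a - sqrt b)\<^sup>2 \<le> \<bar>a - b\<bar>"
proof -
  have "\<bar>sqrt a - sqrt b\<bar> * \<bar>sqrt a - sqrt b\<bar> \<le> \<bar>sqrt a - sqrt b\<bar> * \<bar>sqrt a + sqrt b\<bar>"
    using assms by (intro mult_left_mono) (auto simp: abs_le_iff)
  also have "\<dots> = \<bar>a - b\<bar>"
  proof -
    have "(sqrt a - sqrt b) * (sqrt a + sqrt b) = a - b" using assms by (simp add: algebra_simps)
    then show ?thesis by (simp only: abs_mult[symmetric])
  qed
  finally show ?thesis by (simp add: power2_eq_square abs_mult[symmetric])
qed

lemma sqrt_odds_times:
  fixes t :: real
  assumes "0 < t" "t < 1"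
  shows "sqrt ((1 - t) / t) * t = sqrt (t * (1 - t))"
proof -
  have "sqrt ((1 - t) / t) * t = sqrt ((1 - t) / t) * sqrt (t * t)" using assms by simp
  also have "\<dots> = sqrt (t * (1 - t))" using assms by (simp only: real_sqrt_mult[symmetric]) simp
  finally show ?thesis .
qed

text \<open>Strict positivity of every \<open>L n\<close> is what makes \<open>P\<close> and \<open>P'\<close> equivalent on each \<open>F n\<close>: it
  excludes the values 0 and 1 for the conditional density of \<open>P\<close>.\<close>

locale locally_equivalent_pair = dominated_pair S d P P' + finite_filtration S F G
  for S :: "'a measure" and d P P' and F :: "nat \<Rightarrow> 'a measure" and G +
  fixes L :: "nat \<Rightarrow> 'a \<Rightarrow> real"
  assumes L: "\<And>n. derivative_on (F n) (L n)"
    and L_pos: "\<And>n x. x \<in> space S \<Longrightarrow> 0 < L n x"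
begin

lemma L_F [measurable]: "L n \<in> borel_measurable (F n)"
  using L by (simp add: derivative_on_def)

lemma L_S [measurable]: "L n \<in> borel_measurable S"
  by (rule measurable_from_subalg[OF subalgebra_F L_F])

lemma L_F_mono: "n \<le> k \<Longrightarrow> L n \<in> borel_measurable (F k)"
  by (rule measurable_from_subalg[OF subalgebra_F_F L_F])

definition X :: "nat \<Rightarrow> 'a \<Rightarrow> real" where "X n = real_cond_exp S (F n) d"

definition Y :: "'a \<Rightarrow> real" where "Y = real_cond_exp S G d"

lemma X_F [measurable]: "X n \<in> borel_measurable (F n)"
  by (simp add: X_def)

lemma X_S [measurable]: "X n \<in> borel_measurable S"
  by (rule measurable_from_subalg[OF subalgebra_F X_F])

lemma Y_S [measurable]: "Y \<in> borel_measurable S"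
  by (simp add: Y_def)

lemma X_strict: "AE x in S. \<forall>n. 0 < X n x \<and> X n x < 1"
  unfolding X_def by (subst AE_all_countable) (intro allI cond_density_strict[OF subalgebra_F L L_pos])

lemma L_eq: "AE x in S. \<forall>n. L n x = (1 - X n x) / X n x"
proof -
  have "AE x in S. \<forall>n. L n x * X n x = 1 - X n x"
    unfolding X_def by (subst AE_all_countable) (intro allI derivative_on_times_cond_density[OF subalgebra_F L])
  with X_strict show ?thesis
  proof eventually_elim
    case (elim x)
    show ?case
    proof
      fix n
      have "X n x \<noteq> 0" "L n x * X n x = 1 - X n x" using elim by (auto simp: less_le)
      then show "L n x = (1 - X n x) / X n x" by (simp add: nonzero_eq_divide_eq)
    qed
  qed
qed

lemma X_tendsto_Y: "AE x in S. (\<lambda>n. X n x) \<longlonglongrightarrow> Y x"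
  unfolding X_def Y_def by (rule Levy_upward[OF integrable_d])

text \<open>By a change of measure, \<open>E_P(L k / L n) = E_{P'}(1 / L n) = E_P(L n / L n) = 1\<close>, and
  \<open>sqrt t \<le> 1 + t\<close>.\<close>

lemma integrable_sqrt_ratio:
  assumes "n \<le> k"
  shows "integrable P (\<lambda>x. sqrt (L k x / L n x))"
proof -
  have Ln_k: "L n \<in> borel_measurable (F k)" by (rule L_F_mono[OF assms])
  have inv_n: "(\<lambda>x. ennreal (1 / L n x)) \<in> borel_measurable (F n)"
    and inv_k: "(\<lambda>x. ennreal (1 / L n x)) \<in> borel_measurable (F k)"
    using L_F[of n] Ln_k by measurable
  have "(\<integral>\<^sup>+x. ennreal (L k x / L n x) \<partial>P) = (\<integral>\<^sup>+x. ennreal (L k x) * ennreal (1 / L n x) \<partial>P)"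
    using L_pos by (intro nn_integral_cong) (simp add: ennreal_mult[symmetric] less_imp_le)
  also have "\<dots> = (\<integral>\<^sup>+x. ennreal (1 / L n x) \<partial>P')"
    by (rule derivative_on_nn_integral[OF subalgebra_F L inv_k, symmetric])
  also have "\<dots> = (\<integral>\<^sup>+x. ennreal (L n x) * ennreal (1 / L n x) \<partial>P)"
    by (rule derivative_on_nn_integral[OF subalgebra_F L inv_n])
  also have "\<dots> = (\<integral>\<^sup>+x. 1 \<partial>P)"
  proof (rule nn_integral_cong)
    fix x assume "x \<in> space P"
    then have "0 < L n x" using L_pos by simp
    then show "ennreal (L n x) * ennreal (1 / L n x) = 1" by (simp add: ennreal_mult[symmetric])
  qed
  finally have "(\<integral>\<^sup>+x. ennreal (L k x / L n x) \<partial>P) < \<infinity>" using P.emeasure_space_1 by simp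
  then have ratio: "integrable P (\<lambda>x. L k x / L n x)"
    using L_pos by (intro integrableI_nonneg) (auto simp: less_imp_le)
  show ?thesis
  proof (rule Bochner_Integration.integrable_bound[of _ "\<lambda>x. 1 + L k x / L n x"])
    show "AE x in P. norm (sqrt (L k x / L n x)) \<le> norm (1 + L k x / L n x)"
    proof (rule AE_I2)
      fix x assume "x \<in> space P"
      then have "0 \<le> L k x / L n x" using L_pos by (simp add: less_imp_le)
      moreover from arith_geo_mean_sqrt[OF this, of 1]
      have "sqrt (L k x / L n x) \<le> 1 + L k x / L n x" using \<open>0 \<le> L k x / L n x\<close> by simp
      ultimately show "norm (sqrt (L k x / L n x)) \<le> norm (1 + L k x / L n x)" by simp
    qed
  qed (use ratio in auto)
qed

text \<open>The Hellinger affinity of the two conditional laws on \<open>F k\<close> given \<open>F n\<close>.\<close>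

definition affinity :: "nat \<Rightarrow> nat \<Rightarrow> 'a \<Rightarrow> real" where
  "affinity n k = real_cond_exp P (F n) (\<lambda>x. sqrt (L k x / L n x))"

text \<open>Let \<open>q = sqrt (L k / L n)\<close>. Bayes' formula rewrites the affinity times \<open>X n\<close> as
  \<open>E_S(q d | F n)\<close>, the tower property through \<open>F k\<close> replaces \<open>d\<close> by \<open>X k\<close>. With
  \<open>u k = sqrt (X k * (1 - X k))\<close>, the relation \<open>L k = (1 - X k) / X k\<close> gives \<open>sqrt (L k) X k = u k\<close>,
  and likewise for \<open>n\<close>.\<close>

lemma affinity_eq:
  assumes nk: "n \<le> k"
  shows "AE x in S. affinity n k x =
    real_cond_exp S (F n) (\<lambda>x. sqrt (X k x * (1 - X k x))) x / sqrt (X n x * (1 - X n x))"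
proof -
  interpret N: sigma_finite_subalgebra S "F n" by (rule sigma_finite_subalgebra_F)
  interpret K: sigma_finite_subalgebra S "F k" by (rule sigma_finite_subalgebra_F)
  define q where "q x = sqrt (L k x / L n x)" for x
  define u where "u x = sqrt (X k x * (1 - X k x))" for x
  have q_k: "q \<in> borel_measurable (F k)"
    unfolding q_def using L_F[of k] L_F_mono[OF nk] by measurable
  have [measurable]: "q \<in> borel_measurable S" "u \<in> borel_measurable S"
    unfolding q_def u_def by measurable
  have q: "integrable P q" unfolding q_def by (rule integrable_sqrt_ratio[OF nk])
  then have qd: "integrable S (\<lambda>x. q x * d x)" by (simp add: integrable_P_iff)
  have k1: "AE x in S. real_cond_exp S (F k) (\<lambda>x. q x * d x) x = q x * X k x"
    unfolding X_def using qd q_k by (intro K.real_cond_exp_mult) auto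
  have "AE x in S. q x * X k x = 1 / sqrt (L n x) * u x"
    using L_eq X_strict
  proof eventually_elim
    case (elim x)
    have "sqrt (L k x) * X k x = u x"
      using elim sqrt_odds_times[of "X k x"] by (simp add: u_def)
    then show ?case by (simp add: q_def real_sqrt_divide)
  qed
  with k1 have k2: "AE x in S. real_cond_exp S (F k) (\<lambda>x. q x * d x) x = 1 / sqrt (L n x) * u x"
    by eventually_elim simp
  have "integrable S (real_cond_exp S (F k) (\<lambda>x. q x * d x))" by (rule K.real_cond_exp_int(1)[OF qd])
  then have Lu: "integrable S (\<lambda>x. 1 / sqrt (L n x) * u x)"
    by (rule integrable_cong_AE_imp) (use k2 in auto)
  have "AE x in S. affinity n k x * X n x = real_cond_exp S (F n) (\<lambda>x. q x * d x) x"
    unfolding affinity_def X_def q_def[symmetric, abs_def] by (rule Bayes_formula[OF subalgebra_F q])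
  moreover have "AE x in S. real_cond_exp S (F n) (real_cond_exp S (F k) (\<lambda>x. q x * d x)) x = real_cond_exp S (F n) (\<lambda>x. q x * d x) x"
    by (rule N.real_cond_exp_nested_subalg[OF subalgebra_F subalgebra_F_F[OF nk] qd])
  moreover have "AE x in S. real_cond_exp S (F n) (real_cond_exp S (F k) (\<lambda>x. q x * d x)) x = real_cond_exp S (F n) (\<lambda>x. 1 / sqrt (L n x) * u x) x"
    using k2 by (intro N.real_cond_exp_cong) auto
  moreover have "AE x in S. real_cond_exp S (F n) (\<lambda>x. 1 / sqrt (L n x) * u x) x = 1 / sqrt (L n x) * real_cond_exp S (F n) u x"
    using Lu L_F[of n] by (intro N.real_cond_exp_mult) measurable
  ultimately show ?thesis using L_eq X_strict unfolding u_def[symmetric, abs_def]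
  proof eventually_elim
    case (elim x)
    define t where "t = X n x"
    have t: "0 < t" "t < 1" using elim by (auto simp: t_def)
    have *: "sqrt (L n x) * t = sqrt (t * (1 - t))"
      using elim sqrt_odds_times[OF t] by (simp add: t_def)
    have "0 < sqrt (L n x)" using elim t by (simp add: t_def)
    have "affinity n k x * t = real_cond_exp S (F n) u x / sqrt (L n x)" using elim by (simp add: t_def)
    then have "affinity n k x * (sqrt (L n x) * t) = real_cond_exp S (F n) u x"
      using \<open>0 < sqrt (L n x)\<close> by (simp add: field_simps)
    then show ?case using t unfolding * t_def[symmetric] by (simp add: field_simps)
  qed
qed

text \<open>Conditional dominated convergence for \<open>k\<close>, then \<open>affinity_ratio_limit\<close> with \<open>f = Y\<close> and \<open>g = 1 - Y\<close>
  for \<open>n\<close>. One of the two is always positive, so the case where both vanish does not occur.\<close>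

lemma affinity_iterated_limit:
  "AE x in S. (\<forall>n. convergent (\<lambda>k. affinity n k x)) \<and>
     (\<lambda>n. lim (\<lambda>k. affinity n k x)) \<longlonglongrightarrow> of_bool (0 < Y x \<and> Y x < 1)"
proof -
  \<comment> \<open>\<open>Y\<close> lies between 0 and 1 almost everywhere only; the ratio lemma asks for nonnegative functions.\<close>
  define y where "y x = max 0 (min 1 (Y x))" for x
  define z where "z x = sqrt (y x * (1 - y x))" for x
  define u where "u k x = sqrt (X k x * (1 - X k x))" for k x
  have y_G: "y \<in> borel_measurable G" unfolding y_def Y_def by measurable
  have [measurable]: "y \<in> borel_measurable S" by (rule measurable_from_subalg[OF subalgebra_G y_G])
  have [measurable]: "z \<in> borel_measurable S" "u k \<in> borel_measurable S" for k
    unfolding z_def u_def by measurable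
  have y01: "0 \<le> y x" "y x \<le> 1" for x by (auto simp: y_def)
  have yY: "AE x in S. y x = Y x"
    using cond_density_bounds[OF subalgebra_G] unfolding Y_def[symmetric]
    by eventually_elim (simp add: y_def)
  have y: "integrable S y" "integrable S (\<lambda>x. 1 - y x)"
    using y01 by (auto intro!: integrable_const_bound[of _ 1])
  have yX: "AE x in S. \<forall>n. real_cond_exp S (F n) y x = X n x \<and> real_cond_exp S (F n) (\<lambda>x. 1 - y x) x = 1 - X n x"
  proof (subst AE_all_countable, intro allI)
    fix n
    interpret N: sigma_finite_subalgebra S "F n" by (rule sigma_finite_subalgebra_F)
    have "AE x in S. real_cond_exp S (F n) y x = real_cond_exp S (F n) Y x"
      using yY by (intro N.real_cond_exp_cong) auto
    moreover have "AE x in S. real_cond_exp S (F n) Y x = X n x"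
      unfolding Y_def X_def by (rule N.real_cond_exp_nested_subalg[OF subalgebra_G subalgebra_G_F integrable_d])
    moreover have "AE x in S. real_cond_exp S (F n) (\<lambda>x. 1 - y x) x = real_cond_exp S (F n) (\<lambda>_. 1) x - real_cond_exp S (F n) y x"
      using y by (intro N.real_cond_exp_diff) auto
    moreover have "AE x in S. real_cond_exp S (F n) (\<lambda>_. 1 :: real) x = 1"
      by (intro N.real_cond_exp_F_meas) auto
    ultimately show "AE x in S. real_cond_exp S (F n) y x = X n x \<and> real_cond_exp S (F n) (\<lambda>x. 1 - y x) x = 1 - X n x"
      by eventually_elim simp
  qed
  have u_lim: "AE x in S. (\<lambda>k. u k x) \<longlonglongrightarrow> z x"
    using X_tendsto_Y yY
  proof eventually_elim
    case (elim x)
    then show ?case unfolding u_def z_def by (auto intro!: tendsto_intros)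
  qed
  have u_bound: "AE x in S. \<bar>u k x\<bar> \<le> 1" for k
    using X_strict
  proof eventually_elim
    case (elim x)
    then have X: "0 < X k x" "X k x < 1" by auto
    then have "X k x * (1 - X k x) \<le> 1" by (intro mult_le_one) auto
    with X show ?case by (simp add: u_def)
  qed
  have inner: "AE x in S. \<forall>n. (\<lambda>k. affinity n k x) \<longlonglongrightarrow> real_cond_exp S (F n) z x / u n x"
  proof (subst AE_all_countable, intro allI)
    fix n
    interpret N: sigma_finite_subalgebra S "F n" by (rule sigma_finite_subalgebra_F)
    have "AE x in S. (\<lambda>k. real_cond_exp S (F n) (u k) x) \<longlonglongrightarrow> real_cond_exp S (F n) z x"
      by (rule N.real_cond_exp_dominated_convergence[where w="\<lambda>_. 1"]) (auto simp: u_bound u_lim)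
    moreover have "AE x in S. \<forall>k. n \<le> k \<longrightarrow> affinity n k x = real_cond_exp S (F n) (u k) x / u n x"
      unfolding u_def using affinity_eq by (auto simp: AE_all_countable)
    ultimately show "AE x in S. (\<lambda>k. affinity n k x) \<longlonglongrightarrow> real_cond_exp S (F n) z x / u n x"
      using X_strict
    proof eventually_elim
      case (elim x)
      have "0 < X n x" "X n x < 1" using elim by auto
      then have "u n x \<noteq> 0" by (simp add: u_def)
      then have "(\<lambda>k. real_cond_exp S (F n) (u k) x / u n x) \<longlonglongrightarrow> real_cond_exp S (F n) z x / u n x"
        using elim by (intro tendsto_intros)
      then show ?case
        by (rule Lim_transform_eventually) (use elim in \<open>auto intro!: eventually_sequentiallyI[of n]\<close>)
    qed
  qed
  have "AE x in S. 0 < y x \<or> 0 < 1 - y x \<longrightarrow>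
    (\<lambda>n. real_cond_exp S (F n) (\<lambda>x. sqrt (y x * (1 - y x))) x /
       sqrt (real_cond_exp S (F n) y x * real_cond_exp S (F n) (\<lambda>x. 1 - y x) x))
      \<longlonglongrightarrow> of_bool (0 < y x \<and> 0 < 1 - y x)"
    using y_G y y01 by (intro affinity_ratio_limit) auto
  with yX yY inner show ?thesis
  proof eventually_elim
    case (elim x)
    have "0 < y x \<or> 0 < 1 - y x" by (cases "y x = 0") (use y01[of x] in auto)
    then have "(\<lambda>n. real_cond_exp S (F n) z x / u n x) \<longlonglongrightarrow> of_bool (0 < Y x \<and> Y x < 1)"
      using elim by (simp add: z_def[abs_def] u_def)
    moreover have "lim (\<lambda>k. affinity n k x) = real_cond_exp S (F n) z x / u n x" for n
      using elim by (intro limI) auto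
    moreover have "convergent (\<lambda>k. affinity n k x)" for n using elim by (auto simp: convergent_def)
    ultimately show ?case by simp
  qed
qed

text \<open>Where \<open>0 < Y < 1\<close>, \<open>L n = (1 - X n) / X n\<close> tends to \<open>(1 - Y) / Y = D\<close>. All these
  functions are nonnegative with integral 1 under \<open>P\<close>, so Scheffe's lemma upgrades this to
  convergence in \<open>L\<^sup>1\<close>.\<close>

lemma sqrt_derivatives_tendsto_L2:
  assumes D: "derivative_on G D" and strict: "AE x in S. 0 < Y x \<and> Y x < 1"
  shows "(\<lambda>n. \<integral>x. (sqrt (L n x) - sqrt (D x))\<^sup>2 \<partial>P) \<longlonglongrightarrow> 0"
proof -
  have D_G: "D \<in> borel_measurable G" and D_pos: "x \<in> space S \<Longrightarrow> 0 \<le> D x" for x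
    using D by (auto simp: derivative_on_def)
  have [measurable]: "D \<in> borel_measurable S" by (rule measurable_from_subalg[OF subalgebra_G D_G])
  have D_int: "integrable P D" by (rule derivative_on_integrable[OF subalgebra_G D])
  have L_int: "integrable P (L n)" for n by (rule derivative_on_integrable[OF subalgebra_F L])
  have lim: "AE x in P. (\<lambda>n. L n x) \<longlonglongrightarrow> D x"
  proof (rule AE_P_if_AE_S)
    have "AE x in S. D x * Y x = 1 - Y x"
      unfolding Y_def by (rule derivative_on_times_cond_density[OF subalgebra_G D])
    then show "AE x in S. (\<lambda>n. L n x) \<longlonglongrightarrow> D x"
      using L_eq X_tendsto_Y strict
    proof eventually_elim
      case (elim x)
      have "(\<lambda>n. (1 - X n x) / X n x) \<longlonglongrightarrow> (1 - Y x) / Y x"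
        using elim by (intro tendsto_intros) auto
      moreover have "(1 - Y x) / Y x = D x" using elim by (simp add: field_simps)
      ultimately show ?case using elim by simp
    qed
  qed
  have norm_L: "(\<integral>\<^sup>+x. norm (L n x) \<partial>P) = 1" for n
  proof -
    have "(\<integral>\<^sup>+x. norm (L n x) \<partial>P) = (\<integral>\<^sup>+x. L n x \<partial>P)"
      using L_pos by (intro nn_integral_cong) (simp add: less_imp_le abs_of_pos)
    then show ?thesis by (simp add: derivative_on_integral_1[OF subalgebra_F L])
  qed
  have norm_D: "(\<integral>\<^sup>+x. norm (D x) \<partial>P) = 1"
  proof -
    have "(\<integral>\<^sup>+x. norm (D x) \<partial>P) = (\<integral>\<^sup>+x. D x \<partial>P)"
      using D_pos by (intro nn_integral_cong) simp
    then show ?thesis by (simp add: derivative_on_integral_1[OF subalgebra_G D])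
  qed
  have L1: "(\<lambda>n. \<integral>\<^sup>+x. norm (L n x - D x) \<partial>P) \<longlonglongrightarrow> 0"
    by (rule Scheffe_lemma2[OF _ D_int lim]) (simp_all add: norm_L[simplified] norm_D[simplified])
  have le: "ennreal (\<integral>x. (sqrt (L n x) - sqrt (D x))\<^sup>2 \<partial>P) \<le> (\<integral>\<^sup>+x. norm (L n x - D x) \<partial>P)" for n
  proof -
    have "ennreal (\<integral>x. (sqrt (L n x) - sqrt (D x))\<^sup>2 \<partial>P) \<le> ennreal (\<integral>x. norm (L n x - D x) \<partial>P)"
      using L_int[of n] D_int D_pos L_pos
      by (intro ennreal_leI integral_mono_AE' AE_I2) (auto intro!: sqrt_diff_squared_le simp: less_imp_le)
    also have "\<dots> = (\<integral>\<^sup>+x. norm (L n x - D x) \<partial>P)"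
      using L_int[of n] D_int by (intro nn_integral_eq_integral[symmetric]) auto
    finally show ?thesis .
  qed
  have "(\<lambda>n. ennreal (\<integral>x. (sqrt (L n x) - sqrt (D x))\<^sup>2 \<partial>P)) \<longlonglongrightarrow> 0"
    by (rule tendsto_sandwich[OF _ _ tendsto_const L1]) (use le in auto)
  then show ?thesis
    by (subst (asm) tendsto_ennreal_iff[of _ _ 0, simplified]) auto
qed

end

section \<open>Densities with respect to the sum of two probability measures\<close>

lemma finite_measure_sum_of_measures:
  assumes "finite_measure M" "finite_measure N" "sets N = sets M"
  shows "finite_measure (sum_of_measures M N)"
proof (rule finite_measureI)
  interpret M: finite_measure M by fact
  interpret N: finite_measure N by fact
  have "emeasure (sum_of_measures M N) (space M) = emeasure M (space M) + emeasure N (space M)"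
    by (rule emeasure_sum_of_measures[OF assms(3)]) simp
  then show "emeasure (sum_of_measures M N) (space (sum_of_measures M N)) \<noteq> \<infinity>"
    using M.emeasure_finite N.emeasure_finite by simp
qed

text \<open>The Radon-Nikodym densities of \<open>P\<close> and \<open>P'\<close> add up to a density of the sum with respect
  to itself, hence to 1 almost everywhere; truncating the first at 1 changes it on a null set only.\<close>

lemma exists_density_wrt_sum:
  assumes P: "prob_space P" and P': "prob_space P'" and sets_eq: "sets P' = sets P"
  shows "\<exists>d. dominated_pair (sum_of_measures P P') d P P'"
proof -
  interpret P: prob_space P by fact
  interpret P': prob_space P' by fact
  define S where "S = sum_of_measures P P'"
  have sets_S [simp, measurable_cong]: "sets S = sets P" by (simp add: S_def)
  have S_B: "emeasure S B = emeasure P B + emeasure P' B" if "B \<in> sets P" for B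
    unfolding S_def by (rule emeasure_sum_of_measures[OF sets_eq that])
  interpret S: finite_measure S
    unfolding S_def by (rule finite_measure_sum_of_measures[OF P.finite_measure_axioms P'.finite_measure_axioms sets_eq])
  have "absolutely_continuous S P" "absolutely_continuous S P'"
    by (auto simp: absolutely_continuous_def null_sets_def sets_eq S_B)
  then obtain f g where f [measurable]: "f \<in> borel_measurable S" and f_P: "density S f = P"
    and g [measurable]: "g \<in> borel_measurable S" and g_P': "density S g = P'"
    using S.Radon_Nikodym[of P] S.Radon_Nikodym[of P'] sets_eq by auto
  have "density S (\<lambda>x. f x + g x) = density S (\<lambda>_. 1)"
  proof (rule measure_eqI)
    fix B assume "B \<in> sets (density S (\<lambda>x. f x + g x))"
    then have B [measurable]: "B \<in> sets S" by simp
    have "emeasure (density S (\<lambda>x. f x + g x)) B = emeasure (density S f) B + emeasure (density S g) B"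
      using B by (simp add: emeasure_density distrib_right nn_integral_add del: sets_S)
    also have "\<dots> = emeasure S B" using B by (simp add: f_P g_P' S_B)
    finally show "emeasure (density S (\<lambda>x. f x + g x)) B = emeasure (density S (\<lambda>_. 1)) B"
      by (simp add: density_1)
  qed simp
  then have fg: "AE x in S. f x + g x = 1"
    by (subst (asm) S.density_unique_iff) auto
  define d where "d x = enn2real (min 1 (f x))" for x
  have d_ge: "0 \<le> d x" for x by (simp add: d_def)
  have d_meas [measurable]: "d \<in> borel_measurable S" unfolding d_def by measurable
  have "min 1 (f x) < top" for x
    by (rule le_less_trans[OF min.cobounded1]) simp
  then have d_ennreal: "ennreal (d x) = min 1 (f x)" for x
    unfolding d_def by (rule ennreal_enn2real)
  have d_le: "d x \<le> 1" for x
  proof -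
    have "ennreal (d x) \<le> 1" unfolding d_ennreal by (rule min.cobounded1)
    then show ?thesis by (simp only: ennreal_le_1)
  qed
  have f_d: "AE x in S. f x = ennreal (d x)"
    using fg
  proof eventually_elim
    case (elim x)
    have "f x \<le> f x + g x" by simp
    then have "f x \<le> 1" unfolding elim .
    then show ?case by (simp add: d_ennreal)
  qed
  have g_d: "AE x in S. g x = ennreal (1 - d x)"
    using fg f_d
  proof eventually_elim
    case (elim x)
    have "ennreal (d x) + ennreal (1 - d x) = ennreal (d x + (1 - d x))"
      using d_ge[of x] d_le[of x] by (intro ennreal_plus[symmetric]) auto
    also have "\<dots> = ennreal (d x) + g x" using elim by simp
    finally show ?case by (simp only: ennreal_add_left_cancel ennreal_neq_top) auto
  qed
  have "dominated_pair S d P P'"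
  proof (intro dominated_pair.intro dominated_pair_axioms.intro)
    have "density S f = density S (\<lambda>x. ennreal (d x))"
      by (rule density_cong[OF f _ f_d]) simp
    then show "P = density S (\<lambda>x. ennreal (d x))" by (simp only: f_P)
    have "density S g = density S (\<lambda>x. ennreal (1 - d x))"
      by (rule density_cong[OF g _ g_d]) simp
    then show "P' = density S (\<lambda>x. ennreal (1 - d x))" by (simp only: g_P')
  qed (rule S.finite_measure_axioms d_meas d_ge d_le P P')+
  then show ?thesis unfolding S_def by blast
qed

section \<open>The \<open>\<sigma>\<close>-algebras of coordinate projections\<close>

lemma space_proj_sigma [simp]: "space (proj_sigma A P J) = space P"
  by (simp add: proj_sigma_def)

lemma sets_proj_sigma:
  assumes "sets P = sets (PiM I A)" "J \<subseteq> I"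
  shows "sets (proj_sigma A P J) = {(\<lambda>\<omega>. restrict \<omega> J) -` C \<inter> space P | C. C \<in> sets (PiM J A)}"
proof -
  have "space P = space (PiM I A)" using assms(1) by (rule sets_eq_imp_space_eq)
  then show ?thesis unfolding proj_sigma_def
    using assms(2) by (intro sets_vimage_algebra2) (auto simp: space_PiM)
qed

lemma restrict_measurable_proj_sigma:
  assumes "sets P = sets (PiM I A)" "J \<subseteq> I"
  shows "(\<lambda>\<omega>. restrict \<omega> J) \<in> measurable (proj_sigma A P J) (PiM J A)"
proof -
  have "space P = space (PiM I A)" using assms(1) by (rule sets_eq_imp_space_eq)
  then show ?thesis unfolding proj_sigma_def
    using assms(2) by (intro measurable_vimage_algebra1) (auto simp: space_PiM)
qed

lemma coordinate_measurable_proj_sigma: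
  assumes "sets P = sets (PiM I A)" "J \<subseteq> I" "i \<in> J"
  shows "(\<lambda>\<omega>. \<omega> i) \<in> measurable (proj_sigma A P J) (A i)"
  using measurable_compose[OF restrict_measurable_proj_sigma[OF assms(1,2)] measurable_component_singleton[OF assms(3)]]
    assms(3) by simp

text \<open>Minimality among the \<open>\<sigma>\<close>-algebras that make the coordinates measurable. Inclusions
  of coordinate \<open>\<sigma>\<close>-algebras reduce to checking single coordinates by this lemma.\<close>

lemma proj_sigma_least:
  assumes P: "sets P = sets (PiM I A)" "J \<subseteq> I" and N: "space N = space P"
    and coord: "\<And>i. i \<in> J \<Longrightarrow> (\<lambda>\<omega>. \<omega> i) \<in> measurable N (A i)"
  shows "sets (proj_sigma A P J) \<subseteq> sets N"
proof -
  have "space P = space (PiM I A)" using P(1) by (rule sets_eq_imp_space_eq)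
  then have "(\<lambda>\<omega> i. restrict \<omega> J i) \<in> measurable N (PiM J A)"
    using P(2) coord by (intro measurable_PiM_single') (auto simp: N space_PiM cong: measurable_cong)
  then have "(\<lambda>\<omega>. restrict \<omega> J) \<in> measurable N (PiM J A)" by (simp add: restrict_def)
  then show ?thesis
    unfolding sets_proj_sigma[OF P] N[symmetric] by (auto dest: measurable_sets)
qed

lemma proj_sigma_mono:
  assumes "sets P = sets (PiM I A)" "K \<subseteq> I" "J \<subseteq> K"
  shows "sets (proj_sigma A P J) \<subseteq> sets (proj_sigma A P K)"
  using assms by (intro proj_sigma_least[of P I A] coordinate_measurable_proj_sigma[of P I A]) auto

lemma subalgebra_proj_sigma:
  assumes "sets P = sets (PiM I A)" "J \<subseteq> I"
  shows "subalgebra P (proj_sigma A P J)"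
proof -
  have "(\<lambda>\<omega>. \<omega> i) \<in> measurable P (A i)" if "i \<in> J" for i
    using measurable_component_singleton[of i I A] that assms
    by (simp add: subsetD cong: measurable_cong_sets[OF assms(1) refl])
  then have "sets (proj_sigma A P J) \<subseteq> sets P" by (rule proj_sigma_least[OF assms refl])
  then show ?thesis by (simp add: subalgebra_def)
qed

lemma sets_proj_sigma_UN:
  assumes P: "sets P = sets (PiM I A)" and J: "\<And>n::nat. J n \<subseteq> I"
  shows "sets (proj_sigma A P (\<Union>n. J n)) = sigma_sets (space P) (\<Union>n. sets (proj_sigma A P (J n)))"
proof
  let ?K = "\<Union>n. J n"
  have K: "?K \<subseteq> I" using J by blast
  let ?N = "sigma (space P) (\<Union>n. sets (proj_sigma A P (J n)))"
  have pow: "(\<Union>n. sets (proj_sigma A P (J n))) \<subseteq> Pow (space P)"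
    using sets.sets_into_space by fastforce
  have "sets (proj_sigma A P ?K) \<subseteq> sets ?N"
  proof (rule proj_sigma_least[OF P K])
    fix i assume "i \<in> ?K"
    then obtain n where n: "i \<in> J n" by blast
    have "sets (proj_sigma A P (J n)) \<subseteq> sets ?N" using pow by auto
    then show "(\<lambda>\<omega>. \<omega> i) \<in> measurable ?N (A i)"
      using coordinate_measurable_proj_sigma[OF P J n] pow
      by (auto simp: measurable_def space_measure_of_conv)
  qed (simp add: space_measure_of_conv)
  then show "sets (proj_sigma A P ?K) \<subseteq> sigma_sets (space P) (\<Union>n. sets (proj_sigma A P (J n)))"
    using pow by simp
  have "(\<Union>n. sets (proj_sigma A P (J n))) \<subseteq> sets (proj_sigma A P ?K)"
    using proj_sigma_mono[OF P K] by blast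
  then show "sigma_sets (space P) (\<Union>n. sets (proj_sigma A P (J n))) \<subseteq> sets (proj_sigma A P ?K)"
    using sets.sigma_sets_subset[of _ "proj_sigma A P ?K"] by simp
qed

text \<open>The sets supported by countably many coordinates form a \<open>\<sigma>\<close>-algebra that contains the
  one-coordinate cylinders.\<close>

lemma countable_coordinate_support:
  assumes P: "sets P = sets (PiM I A)" and B: "B \<in> sets P"
  shows "\<exists>K\<subseteq>I. countable K \<and> B \<in> sets (proj_sigma A P K)"
proof -
  have space_P: "space P = (\<Pi>\<^sub>E i\<in>I. space (A i))"
    using sets_eq_imp_space_eq[OF P] by (simp add: space_PiM)
  from B show ?thesis unfolding P sets_PiM_single
  proof (induction rule: sigma_sets.induct)
    case (Basic B)
    then obtain i C where i: "i \<in> I" "C \<in> sets (A i)" and B: "B = {f \<in> space P. f i \<in> C}"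
      by (auto simp: space_P)
    have "B = (\<lambda>\<omega>. \<omega> i) -` C \<inter> space (proj_sigma A P {i})" by (auto simp: B)
    moreover have "\<dots> \<in> sets (proj_sigma A P {i})"
      using i by (intro measurable_sets[OF coordinate_measurable_proj_sigma[OF P]]) auto
    ultimately show ?case using i by (intro exI[of _ "{i}"]) auto
  next
    case Empty
    show ?case by (intro exI[of _ "{}"]) auto
  next
    case (Compl B)
    then obtain K where K: "K \<subseteq> I" "countable K" "B \<in> sets (proj_sigma A P K)" by blast
    have "space (proj_sigma A P K) - B \<in> sets (proj_sigma A P K)" using K(3) by blast
    then show ?case using K by (intro exI[of _ K]) (simp add: space_P)
  next
    case (Union B)
    then have "\<forall>n::nat. \<exists>K. K \<subseteq> I \<and> countable K \<and> B n \<in> sets (proj_sigma A P K)" by blast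
    then obtain K where K: "\<And>n. K n \<subseteq> I" "\<And>n. countable (K n)" "\<And>n. B n \<in> sets (proj_sigma A P (K n))"
      by metis
    have "B n \<in> sets (proj_sigma A P (\<Union>n. K n))" for n
      using proj_sigma_mono[OF P, of "\<Union>n. K n" "K n"] K by blast
    then show ?case using K by (intro exI[of _ "\<Union>n. K n"]) auto
  qed
qed

text \<open>The \<open>n\<close>-th set takes the first \<open>n - 1\<close> positions of an enumeration of \<open>K\<close>, so that the set with
  index 1 is empty.\<close>

lemma admissible_seq_exhausting:
  assumes "countable K" "K \<subseteq> I"
  shows "\<exists>J. admissible_seq I J \<and> (\<Union>n\<in>{1..}. J n) = K"
proof -
  define J where "J n = {k\<in>K. to_nat_on K k < n - 1}" for n
  have "finite (J n)" for n
  proof (rule inj_on_finite)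
    show "inj_on (to_nat_on K) (J n)"
      using inj_on_to_nat_on[OF assms(1)] by (rule inj_on_subset) (auto simp: J_def)
    show "to_nat_on K ` J n \<subseteq> {..<n - 1}" by (auto simp: J_def)
  qed simp
  then have "admissible_seq I J"
    using assms(2) by (auto simp: admissible_seq_def J_def)
  moreover have "k \<in> (\<Union>n\<in>{1..}. J n)" if "k \<in> K" for k
    using that by (intro UN_I[of "to_nat_on K k + 2"]) (auto simp: J_def)
  then have "(\<Union>n\<in>{1..}. J n) = K" by (auto simp: J_def)
  ultimately show ?thesis by blast
qed

lemma prod_sqrt_deriv_ratio:
  assumes pos: "\<And>i. 1 \<le> i \<Longrightarrow> 0 < \<Phi> (J i) (restrict \<omega> (J i))" and "1 \<le> n" "n \<le> k"
  shows "(\<Prod>i=n..k. sqrt (deriv_ratio \<Phi> (J (Suc i)) (J i) \<omega>)) =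
    sqrt (\<Phi> (J (Suc k)) (restrict \<omega> (J (Suc k))) / \<Phi> (J n) (restrict \<omega> (J n)))"
proof -
  define g where "g i = \<Phi> (J i) (restrict \<omega> (J i))" for i
  have ratio: "deriv_ratio \<Phi> (J (Suc i)) (J i) \<omega> = g (Suc i) / g i" for i
    by (simp only: deriv_ratio_def g_def)
  have "(\<Prod>i=n..k. sqrt (g (Suc i) / g i)) = sqrt (g (Suc k) / g n)"
    using assms(3)
  proof (induction k rule: dec_induct)
    case (step k)
    have "g (Suc k) \<noteq> 0" using pos[of "Suc k"] by (simp add: g_def)
    have "(\<Prod>i=n..Suc k. sqrt (g (Suc i) / g i)) = sqrt (g (Suc k) / g n) * sqrt (g (Suc (Suc k)) / g (Suc k))"
      using step by simp
    also have "\<dots> = sqrt ((g (Suc k) / g n) * (g (Suc (Suc k)) / g (Suc k)))" by (rule real_sqrt_mult[symmetric])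
    also have "(g (Suc k) / g n) * (g (Suc (Suc k)) / g (Suc k)) = g (Suc (Suc k)) / g n"
      using \<open>g (Suc k) \<noteq> 0\<close> by simp
    finally show ?case .
  qed simp
  then show ?thesis by (simp only: ratio g_def)
qed

text \<open>Transport of a Radon-Nikodym derivative between marginal laws to the product space, by change of
  variables along the projection. Applied to the finite sets of a sequence and, for the \<open>L\<^sup>2\<close> limit, to
  their union.\<close>

lemma derivative_on_proj_sigma:
  assumes "dominated_pair S d P P'" and sets_S: "sets S = sets (PiM I A)" and J: "J \<subseteq> I"
    and ac: "absolutely_continuous (proj_law A P J) (proj_law A P' J)"
    and \<phi>: "\<phi> \<in> borel_measurable (PiM J A)" "\<And>x. x \<in> space (PiM J A) \<Longrightarrow> 0 \<le> \<phi> x"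
    and RN: "AE x in proj_law A P J. ennreal (\<phi> x) = RN_deriv (proj_law A P J) (proj_law A P' J) x"
  shows "dominated_pair.derivative_on S P P' (proj_sigma A P J) (\<lambda>\<omega>. \<phi> (restrict \<omega> J))"
proof -
  interpret dominated_pair S d P P' by fact
  have P: "sets P = sets (PiM I A)" and P': "sets P' = sets (PiM I A)" using sets_S by simp_all
  have space_S: "space S = space (PiM I A)" using sets_S by (rule sets_eq_imp_space_eq)
  have r: "(\<lambda>\<omega>. restrict \<omega> J) \<in> measurable P (PiM J A)" "(\<lambda>\<omega>. restrict \<omega> J) \<in> measurable P' (PiM J A)"
    unfolding measurable_cong_sets[OF P refl] measurable_cong_sets[OF P' refl]
    by (rule measurable_restrict_subset[OF J])+
  interpret Q: prob_space "proj_law A P J" unfolding proj_law_def by (rule P.prob_space_distr[OF r(1)])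
  show ?thesis unfolding derivative_on_def
  proof (intro conjI ballI)
    show "(\<lambda>\<omega>. \<phi> (restrict \<omega> J)) \<in> borel_measurable (proj_sigma A P J)"
      by (rule measurable_compose[OF restrict_measurable_proj_sigma[OF P J] \<phi>(1)])
    show "0 \<le> \<phi> (restrict x J)" if "x \<in> space S" for x
      using that J by (intro \<phi>(2)) (auto simp: space_S space_PiM)
    fix B assume "B \<in> sets (proj_sigma A P J)"
    then obtain C where C: "C \<in> sets (PiM J A)" and B: "B = (\<lambda>\<omega>. restrict \<omega> J) -` C \<inter> space S"
      by (auto simp: sets_proj_sigma[OF P J])
    have "emeasure P' B = emeasure (proj_law A P' J) C"
      unfolding proj_law_def by (simp add: emeasure_distr[OF r(2) C] B)
    also have "\<dots> = emeasure (density (proj_law A P J) (RN_deriv (proj_law A P J) (proj_law A P' J))) C"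
      using Q.density_RN_deriv[OF ac] by (simp add: proj_law_def)
    also have "\<dots> = (\<integral>\<^sup>+x. RN_deriv (proj_law A P J) (proj_law A P' J) x * indicator C x \<partial>proj_law A P J)"
      by (rule emeasure_density) (auto simp: proj_law_def C)
    also have "\<dots> = (\<integral>\<^sup>+x. ennreal (\<phi> x) * indicator C x \<partial>proj_law A P J)"
      by (intro nn_integral_cong_AE, use RN in eventually_elim) simp
    also have "\<dots> = (\<integral>\<^sup>+\<omega>. ennreal (\<phi> (restrict \<omega> J)) * indicator C (restrict \<omega> J) \<partial>P)"
    proof -
      have "(\<lambda>x. ennreal (\<phi> x) * indicator C x) \<in> borel_measurable (PiM J A)"
        using C \<phi>(1) by measurable
      then show ?thesis unfolding proj_law_def by (subst nn_integral_distr[OF r(1)]) simp_all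
    qed
    also have "\<dots> = (\<integral>\<^sup>+\<omega>. ennreal (\<phi> (restrict \<omega> J)) * indicator B \<omega> \<partial>P)"
      by (intro nn_integral_cong) (simp add: B indicator_def)
    finally show "emeasure P' B = (\<integral>\<^sup>+\<omega>. ennreal (\<phi> (restrict \<omega> J)) * indicator B \<omega> \<partial>P)" .
  qed
qed

section \<open>The equivalence criterion\<close>

theorem corollary5p2:
  fixes I :: "'i set" and A :: "'i \<Rightarrow> 'a measure"
    and P P' :: "('i \<Rightarrow> 'a) measure"
    and \<Phi> :: "'i set \<Rightarrow> ('i \<Rightarrow> 'a) \<Rightarrow> real"
  assumes "prob_space P" and "prob_space P'"
    and "sets P = sets (PiM I A)" and "sets P' = sets (PiM I A)"
    and "\<And>J. finite J \<Longrightarrow> J \<subseteq> I \<Longrightarrow> mutually_abs_cont (proj_law A P J) (proj_law A P' J)"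
    and "RN_versions I A P P' \<Phi>"
  shows "(\<forall>J. admissible_seq I J \<longrightarrow>
            (AE \<omega> in sum_of_measures P P'. M_exists_at A P \<Phi> J \<omega>))
    \<and> (mutually_abs_cont P P' \<longleftrightarrow>
         (\<forall>J. admissible_seq I J \<longrightarrow>
            (AE \<omega> in sum_of_measures P P'. M_lim A P \<Phi> J \<omega> = 1)))
    \<and> (mutually_abs_cont P P' \<longrightarrow>
         (\<forall>J. admissible_seq I J \<longrightarrow>
            (let K = (\<Union>n\<in>{1..}. J n) in
             tendsto_L2 P
               (\<lambda>n \<omega>. sqrt (\<Phi> (J n) (restrict \<omega> (J n))))
               (\<lambda>\<omega>. sqrt (enn2real
                  (RN_deriv (proj_law A P K) (proj_law A P' K) (restrict \<omega> K)))))))"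
proof -
  have events_P: "sets P = sets (PiM I A)" and events_P': "sets P' = sets P"
    using assms(3,4) by (simp_all only:)
  define S where "S = sum_of_measures P P'"
  have sets_S: "sets S = sets (PiM I A)" and space_S: "space S = space P"
    by (simp_all only: S_def sets_sum_of_measures space_sum_of_measures events_P)
  have space_eq: "space S = space (PiM I A)" using sets_S by (rule sets_eq_imp_space_eq)
  obtain d where pair_d: "dominated_pair S d P P'"
    unfolding S_def using exists_density_wrt_sum[OF assms(1,2) events_P'] ..
  interpret dominated_pair S d P P' by (rule pair_d)
  \<comment> \<open>Sequences start at index 1, filtrations at index 0, so time \<open>n\<close> corresponds to \<open>J (Suc n)\<close>.\<close>
  define U where "U J = (\<Union>n. J (Suc n))" for J :: "nat \<Rightarrow> 'i set"
  have U_eq: "(\<Union>n\<in>{1..}. J n) = U J" for J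
  proof
    show "(\<Union>n\<in>{1..}. J n) \<subseteq> U J"
    proof (rule UN_least)
      fix n :: nat assume "n \<in> {1..}"
      then have "J n = J (Suc (n - 1))" by simp
      then show "J n \<subseteq> U J" unfolding U_def by blast
    qed
    show "U J \<subseteq> (\<Union>n\<in>{1..}. J n)" unfolding U_def by auto
  qed
  have pair: "locally_equivalent_pair S d P P' (\<lambda>n. proj_sigma A P (J (Suc n))) (proj_sigma A P (U J))
      (\<lambda>n \<omega>. \<Phi> (J (Suc n)) (restrict \<omega> (J (Suc n))))"
    if J: "admissible_seq I J" for J
  proof -
    have fin: "finite (J (Suc n))" "J (Suc n) \<subseteq> I" and step: "J (Suc n) \<subseteq> J (Suc (Suc n))" for n
      using J by (auto simp: admissible_seq_def)
    have mono: "J (Suc m) \<subseteq> J (Suc n)" if "m \<le> n" for m n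
      using lift_Suc_mono_le[of "\<lambda>n. J (Suc n)", OF step that] .
    show ?thesis
    proof (intro locally_equivalent_pair.intro locally_equivalent_pair_axioms.intro
        finite_filtration.intro finite_filtration_axioms.intro)
      show "dominated_pair S d P P'" by (rule pair_d)
      show "finite_measure S" by (rule finite_measure_axioms)
      show "subalgebra S (proj_sigma A P (J (Suc n)))" for n
        using subalgebra_proj_sigma[OF events_P fin(2)[of n]] by (simp add: subalgebra_def)
      show "sets (proj_sigma A P (J (Suc m))) \<subseteq> sets (proj_sigma A P (J (Suc n)))" if "m \<le> n" for m n
        by (rule proj_sigma_mono[OF events_P fin(2) mono[OF that]])
      show "space (proj_sigma A P (U J)) = space S" by simp
      show "sets (proj_sigma A P (U J)) = sigma_sets (space S) (\<Union>n. sets (proj_sigma A P (J (Suc n))))"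
        unfolding U_def space_S by (rule sets_proj_sigma_UN[OF events_P fin(2)])
      have \<Phi>: "\<Phi> (J (Suc n)) \<in> borel_measurable (PiM (J (Suc n)) A)"
        "x \<in> space (PiM (J (Suc n)) A) \<Longrightarrow> 0 < \<Phi> (J (Suc n)) x"
        "AE x in proj_law A P (J (Suc n)). ennreal (\<Phi> (J (Suc n)) x) =
           RN_deriv (proj_law A P (J (Suc n))) (proj_law A P' (J (Suc n))) x" for n x
        using assms(6) fin[of n] unfolding RN_versions_def by blast+
      show "derivative_on (proj_sigma A P (J (Suc n))) (\<lambda>\<omega>. \<Phi> (J (Suc n)) (restrict \<omega> (J (Suc n))))" for n
        using assms(5)[OF fin[of n]] unfolding mutually_abs_cont_def
        by (intro derivative_on_proj_sigma[OF pair_d sets_S fin(2) _ \<Phi>(1) less_imp_le[OF \<Phi>(2)] \<Phi>(3)]) auto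
      show "0 < \<Phi> (J (Suc n)) (restrict \<omega> (J (Suc n)))" if "\<omega> \<in> space S" for n \<omega>
        using that fin(2)[of n] by (intro \<Phi>(2)) (auto simp: space_eq space_PiM)
    qed
  qed
  define Y where "Y J = real_cond_exp S (proj_sigma A P (U J)) d" for J
  \<comment> \<open>The iterated limit is the indicator of the set where the limit density is strictly between 0 and 1.\<close>
  have main: "AE \<omega> in S. M_exists_at A P \<Phi> J \<omega> \<and> M_lim A P \<Phi> J \<omega> = of_bool (0 < Y J \<omega> \<and> Y J \<omega> < 1)"
    if J: "admissible_seq I J" for J
  proof -
    interpret pair: locally_equivalent_pair S d P P' "\<lambda>n. proj_sigma A P (J (Suc n))" "proj_sigma A P (U J)"
      "\<lambda>n \<omega>. \<Phi> (J (Suc n)) (restrict \<omega> (J (Suc n)))"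
      by (rule pair[OF J])
    have pos: "0 < \<Phi> (J i) (restrict \<omega> (J i))" if "\<omega> \<in> space S" "1 \<le> i" for \<omega> i
      using pair.L_pos[OF that(1), of "i - 1"] that(2) by simp
    have meas: "(\<lambda>\<omega>. \<Phi> (J i) (restrict \<omega> (J i))) \<in> borel_measurable P" if "1 \<le> i" for i
      using pair.L_S[of "i - 1"] that by simp
    \<comment> \<open>For \<open>k < n\<close> the product is empty and the identity fails, which does not affect limits in \<open>k\<close>.\<close>
    have cond_prod_eq: "cond_prod A P \<Phi> J (Suc n) k = pair.affinity n k" if "Suc n \<le> k" for n k
    proof -
      have tele: "(\<Prod>i=Suc n..k. sqrt (deriv_ratio \<Phi> (J (Suc i)) (J i) \<omega>)) =
          sqrt (\<Phi> (J (Suc k)) (restrict \<omega> (J (Suc k))) / \<Phi> (J (Suc n)) (restrict \<omega> (J (Suc n))))"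
        if "\<omega> \<in> space S" for \<omega>
        by (rule prod_sqrt_deriv_ratio[where \<Phi>=\<Phi> and J=J and \<omega>=\<omega>, OF pos[OF that] _ \<open>Suc n \<le> k\<close>]) simp_all
      have meas_ratio: "(\<lambda>\<omega>. sqrt (\<Phi> (J (Suc k)) (restrict \<omega> (J (Suc k))) / \<Phi> (J (Suc n)) (restrict \<omega> (J (Suc n)))))
          \<in> borel_measurable P"
        using meas[of "Suc k"] meas[of "Suc n"] by simp
      show ?thesis unfolding cond_prod_def pair.affinity_def
      proof (rule real_cond_exp_eq_if_AE_eq)
        show "AE \<omega> in P. (\<Prod>i=Suc n..k. sqrt (deriv_ratio \<Phi> (J (Suc i)) (J i) \<omega>)) =
            sqrt (\<Phi> (J (Suc k)) (restrict \<omega> (J (Suc k))) / \<Phi> (J (Suc n)) (restrict \<omega> (J (Suc n))))"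
          by (rule AE_I2) (simp add: tele)
        show "(\<lambda>\<omega>. \<Prod>i=Suc n..k. sqrt (deriv_ratio \<Phi> (J (Suc i)) (J i) \<omega>)) \<in> borel_measurable P"
          by (subst measurable_cong[OF tele]) (simp_all add: meas_ratio)
      qed (rule meas_ratio)
    qed
    from pair.affinity_iterated_limit show ?thesis
    proof eventually_elim
      case (elim \<omega>)
      have conv: "(\<lambda>k. cond_prod A P \<Phi> J (Suc n) k \<omega>) \<longlonglongrightarrow> lim (\<lambda>k. pair.affinity n k \<omega>)" for n
      proof (rule Lim_transform_eventually)
        show "(\<lambda>k. pair.affinity n k \<omega>) \<longlonglongrightarrow> lim (\<lambda>k. pair.affinity n k \<omega>)"
          using elim by (simp add: convergent_LIMSEQ_iff)
        show "eventually (\<lambda>k. pair.affinity n k \<omega> = cond_prod A P \<Phi> J (Suc n) k \<omega>) sequentially"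
          by (rule eventually_sequentiallyI[of "Suc n"]) (simp add: cond_prod_eq)
      qed
      have "(\<lambda>n. lim (\<lambda>k. cond_prod A P \<Phi> J (Suc n) k \<omega>)) \<longlonglongrightarrow> of_bool (0 < Y J \<omega> \<and> Y J \<omega> < 1)"
        using elim by (simp add: limI[OF conv] Y_def pair.Y_def)
      then have lim: "(\<lambda>n. lim (\<lambda>k. cond_prod A P \<Phi> J n k \<omega>)) \<longlonglongrightarrow> of_bool (0 < Y J \<omega> \<and> Y J \<omega> < 1)"
        by (rule LIMSEQ_imp_Suc)
      have "convergent (\<lambda>k. cond_prod A P \<Phi> J n k \<omega>)" if "1 \<le> n" for n
        using conv[of "n - 1"] that by (auto simp: convergent_def)
      then show ?case
        using lim by (auto simp: M_exists_at_def M_lim_def convergent_def intro: limI)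
    qed
  qed
  have null_iff: "mutually_abs_cont P P' \<longleftrightarrow> (\<forall>B\<in>sets P. emeasure P B = 0 \<longleftrightarrow> emeasure P' B = 0)"
    by (auto simp: mutually_abs_cont_def absolutely_continuous_def null_sets_def)
  have K_sub: "U J \<subseteq> I" if "admissible_seq I J" for J
    using that by (auto simp: admissible_seq_def U_def)
  have subalg: "subalgebra S (proj_sigma A P K)" if "K \<subseteq> I" for K
    using subalgebra_proj_sigma[OF events_P that] by (simp add: subalgebra_def)
  have strict: "AE \<omega> in S. 0 < Y J \<omega> \<and> Y J \<omega> < 1" if "mutually_abs_cont P P'" "admissible_seq I J" for J
  proof -
    note sub = subalg[OF K_sub[OF that(2)]]
    have "\<forall>B\<in>sets (proj_sigma A P (U J)). emeasure P B = 0 \<longleftrightarrow> emeasure P' B = 0"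
      using that(1) sub unfolding null_iff by (auto simp: subalgebra_def)
    then show ?thesis unfolding Y_def equivalent_iff_cond_density_strict[OF sub] .
  qed
  have equiv: "mutually_abs_cont P P'"
    if M1: "\<And>J. admissible_seq I J \<Longrightarrow> AE \<omega> in S. M_lim A P \<Phi> J \<omega> = 1"
    unfolding null_iff
  proof
    fix B assume "B \<in> sets P"
    then obtain K where K: "K \<subseteq> I" "countable K" "B \<in> sets (proj_sigma A P K)"
      using countable_coordinate_support[OF events_P] by blast
    obtain J where J: "admissible_seq I J" and "(\<Union>n\<in>{1..}. J n) = K"
      using admissible_seq_exhausting[OF K(2,1)] by blast
    then have U: "U J = K" by (simp only: U_eq)
    have "AE \<omega> in S. 0 < Y J \<omega> \<and> Y J \<omega> < 1"
      using M1[OF J] main[OF J] by eventually_elim (auto split: if_splits)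
    then have "\<forall>B\<in>sets (proj_sigma A P K). emeasure P B = 0 \<longleftrightarrow> emeasure P' B = 0"
      unfolding equivalent_iff_cond_density_strict[OF subalg[OF K(1)]] by (simp only: Y_def U)
    with K(3) show "emeasure P B = 0 \<longleftrightarrow> emeasure P' B = 0" by blast
  qed
  have L2: "tendsto_L2 P (\<lambda>n \<omega>. sqrt (\<Phi> (J n) (restrict \<omega> (J n))))
      (\<lambda>\<omega>. sqrt (enn2real (RN_deriv (proj_law A P K) (proj_law A P' K) (restrict \<omega> K))))"
    if ac: "mutually_abs_cont P P'" and J: "admissible_seq I J" and K: "K = U J" for J K
  proof -
    interpret pair: locally_equivalent_pair S d P P' "\<lambda>n. proj_sigma A P (J (Suc n))" "proj_sigma A P K"
      "\<lambda>n \<omega>. \<Phi> (J (Suc n)) (restrict \<omega> (J (Suc n)))"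
      unfolding K by (rule pair[OF J])
    have K_I: "K \<subseteq> I" using K_sub[OF J] K by simp
    have r: "(\<lambda>\<omega>. restrict \<omega> K) \<in> measurable P (PiM K A)" "(\<lambda>\<omega>. restrict \<omega> K) \<in> measurable P' (PiM K A)"
      unfolding measurable_cong_sets[OF events_P refl] measurable_cong_sets[OF assms(4) refl]
      by (rule measurable_restrict_subset[OF K_I])+
    define \<phi> where "\<phi> x = enn2real (RN_deriv (proj_law A P K) (proj_law A P' K) x)" for x
    interpret Q: prob_space "proj_law A P K" unfolding proj_law_def by (rule P.prob_space_distr[OF r(1)])
    interpret Q': prob_space "proj_law A P' K" unfolding proj_law_def by (rule P'.prob_space_distr[OF r(2)])
    have ac_K: "absolutely_continuous (proj_law A P K) (proj_law A P' K)"
      unfolding absolutely_continuous_def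
    proof
      fix C assume "C \<in> null_sets (proj_law A P K)"
      then have C: "C \<in> sets (PiM K A)" "emeasure P ((\<lambda>\<omega>. restrict \<omega> K) -` C \<inter> space P) = 0"
        by (auto simp: null_sets_def proj_law_def emeasure_distr[OF r(1)])
      then have "emeasure P' ((\<lambda>\<omega>. restrict \<omega> K) -` C \<inter> space P) = 0"
        using ac measurable_sets[OF r(1) C(1)] unfolding null_iff by blast
      then show "C \<in> null_sets (proj_law A P' K)"
        using C(1) by (simp add: null_sets_def proj_law_def emeasure_distr[OF r(2)])
    qed
    have sets_Q: "sets (proj_law A P' K) = sets (proj_law A P K)" by (simp add: proj_law_def)
    have "AE x in proj_law A P K. RN_deriv (proj_law A P K) (proj_law A P' K) x \<noteq> \<infinity>"
      by (rule Q.RN_deriv_finite[OF Q'.sigma_finite_measure_axioms ac_K sets_Q])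
    then have RN: "AE x in proj_law A P K. ennreal (\<phi> x) = RN_deriv (proj_law A P K) (proj_law A P' K) x"
      by eventually_elim (simp add: \<phi>_def less_top)
    have \<phi>_meas: "\<phi> \<in> borel_measurable (PiM K A)"
    proof -
      have "\<phi> \<in> borel_measurable (proj_law A P K)" unfolding \<phi>_def by measurable
      then show ?thesis by (simp add: proj_law_def)
    qed
    have D: "derivative_on (proj_sigma A P K) (\<lambda>\<omega>. \<phi> (restrict \<omega> K))"
      by (rule derivative_on_proj_sigma[OF pair_d sets_S K_I ac_K \<phi>_meas _ RN]) (simp add: \<phi>_def)
    have D_int: "integrable P (\<lambda>\<omega>. \<phi> (restrict \<omega> K))"
      by (rule derivative_on_integrable[OF subalg[OF K_I] D])
    have "AE \<omega> in S. 0 < pair.Y \<omega> \<and> pair.Y \<omega> < 1"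
      using strict[OF ac J] unfolding pair.Y_def unfolding Y_def K .
    from pair.sqrt_derivatives_tendsto_L2[OF D this]
    have lim: "(\<lambda>n. \<integral>\<omega>. (sqrt (\<Phi> (J n) (restrict \<omega> (J n))) - sqrt (\<phi> (restrict \<omega> K)))\<^sup>2 \<partial>P) \<longlonglongrightarrow> 0"
      by (rule LIMSEQ_imp_Suc)
    have "in_L2 P (\<lambda>\<omega>. sqrt (\<phi> (restrict \<omega> K)))"
      unfolding in_L2_def using D_int borel_measurable_integrable[OF D_int] by (simp add: \<phi>_def)
    moreover have "in_L2 P (\<lambda>\<omega>. sqrt (\<Phi> (J n) (restrict \<omega> (J n))))" if "1 \<le> n" for n
    proof -
      have "integrable P (\<lambda>\<omega>. \<Phi> (J (Suc (n - 1))) (restrict \<omega> (J (Suc (n - 1)))))"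
        by (rule derivative_on_integrable[OF pair.subalgebra_F pair.L])
      then have int: "integrable P (\<lambda>\<omega>. \<Phi> (J n) (restrict \<omega> (J n)))" using that by simp
      have "integrable P (\<lambda>\<omega>. (sqrt (\<Phi> (J n) (restrict \<omega> (J n))))\<^sup>2)"
      proof (subst Bochner_Integration.integrable_cong[OF refl])
        fix \<omega> assume "\<omega> \<in> space P"
        then have "0 < \<Phi> (J n) (restrict \<omega> (J n))" using pair.L_pos[of \<omega> "n - 1"] that by simp
        then show "(sqrt (\<Phi> (J n) (restrict \<omega> (J n))))\<^sup>2 = \<Phi> (J n) (restrict \<omega> (J n))" by simp
      qed (rule int)
      then show ?thesis unfolding in_L2_def using borel_measurable_integrable[OF int] by simp
    qed
    ultimately show ?thesis using lim unfolding tendsto_L2_def \<phi>_def by blast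
  qed
  show ?thesis unfolding Let_def U_eq S_def[symmetric]
  proof (intro conjI allI impI iffI)
    fix J assume J: "admissible_seq I J"
    show "AE \<omega> in S. M_exists_at A P \<Phi> J \<omega>" using main[OF J] by eventually_elim simp
    show "AE \<omega> in S. M_lim A P \<Phi> J \<omega> = 1" if "mutually_abs_cont P P'"
      using main[OF J] strict[OF that J] by eventually_elim simp
  qed (use equiv L2 in blast)+
qed

end
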